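(* Let $X_1,\dots,X_n$ be i.i.d. with density $f(x;\theta_0)$ belonging to a full-rank exponential family $f(x;\theta)=\exp\{\theta^{\mathsf T}b(x)-A(\theta)\}$, $\theta\in\Theta\subseteq\mathbb R^p$. Suppose that (A.1) $q_n>0$ is a sequence with $q_n\to1$ as $n\to\infty$, and (A.2) $\Theta$ is compact and $\theta_0$ is an interior point of $\Theta$. Then, with probability going to $1$ as $n\to\infty$, the $L_q$-likelihood equation $$\sum_{i=1}^nU^*(X_i;\theta,q_n)=0$$ yields a unique solution $\widetilde\theta_n$ that is the maximizer of the $L_q$-likelihood function $\theta\mapsto\sum_{i=1}^nL_{q_n}[f(X_i;\theta)]$ in $\Theta$. Furthermore, $\widetilde\theta_n\xrightarrow{P}\theta_0$.
   Context: Exponential family: $\mu$ is a $\sigma$-finite measure on a measurable space $(\Omega,\mathscr F)$, $b(x)=(b_1(x),\dots,b_p(x))^{\mathsf T}$ is a vector of real measurable functions, $A(\theta)=\log\int_\Omega e^{\theta^{\mathsf T}b(x)}\,d\mu(x)$ (finite on $\Theta$), and $f(\cdot;\theta)$ is a density with respect to $\mu$. The family is of full rank (the functions $b_1,\dots,b_p$ satisfy no nontrivial affine relation $\mu$-almost everywhere). For $u>0$, $L_q(u)=\log u$ if $q=1$ and $L_q(u)=(u^{1-q}-1)/(1-q)$ if $q\neq1$ ($q>0$). The maximum L$q$-likelihood estimator (ML$q$E) is $\widetilde\theta_n=\arg\max_{\theta\in\Theta}\sum_{i=1}^nL_{q_n}[f(X_i;\theta)]$. Score and modified score: $U(x;\theta)=\nabla_\theta\log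 f(x;\theta)$ and $U^*(x;\theta,q)=U(x;\theta)f(x;\theta)^{1-q}$. *)

theory Defs
  imports "HOL-Probability.Probability"
begin

definition natural_space :: "'x measure \<Rightarrow> ('x \<Rightarrow> real ^ 'p) \<Rightarrow> (real ^ 'p) set" where
  "natural_space \<mu> b = {\<theta>. integrable \<mu> (\<lambda>x. exp (\<theta> \<bullet> b x))}"

(* meaningful for parameters in natural_space only *)
definition log_partition :: "'x measure \<Rightarrow> ('x \<Rightarrow> real ^ 'p) \<Rightarrow> real ^ 'p \<Rightarrow> real" where
  "log_partition \<mu> b \<theta> = ln (\<integral>x. exp (\<theta> \<bullet> b x) \<partial>\<mu>)"

definition expfam_density :: "'x measure \<Rightarrow> ('x \<Rightarrow> real ^ 'p) \<Rightarrow> 'x \<Rightarrow> real ^ 'p \<Rightarrow> real" where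
  "expfam_density \<mu> b x \<theta> = exp (\<theta> \<bullet> b x - log_partition \<mu> b \<theta>)"

definition full_rank :: "'x measure \<Rightarrow> ('x \<Rightarrow> real ^ 'p) \<Rightarrow> bool" where
  "full_rank \<mu> b \<longleftrightarrow>
     (\<forall>c a. (AE x in \<mu>. (\<Sum>j\<in>UNIV. c $ j * b x $ j) + a = 0) \<longrightarrow> c = 0 \<and> a = 0)"

definition Lq :: "real \<Rightarrow> real \<Rightarrow> real" where
  "Lq q u = (if q = 1 then ln u else (u powr (1 - q) - 1) / (1 - q))"

definition score :: "('x \<Rightarrow> real ^ 'p \<Rightarrow> real) \<Rightarrow> 'x \<Rightarrow> real ^ 'p \<Rightarrow> real ^ 'p" where
  "score f x \<theta> = (THE D. GDERIV (\<lambda>t. ln (f x t)) \<theta> :> D)"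

definition modified_score ::
    "('x \<Rightarrow> real ^ 'p \<Rightarrow> real) \<Rightarrow> 'x \<Rightarrow> real ^ 'p \<Rightarrow> real \<Rightarrow> real ^ 'p" where
  "modified_score f x \<theta> q = (f x \<theta> powr (1 - q)) *\<^sub>R score f x \<theta>"

definition Lq_likelihood ::
    "('x \<Rightarrow> real ^ 'p \<Rightarrow> real) \<Rightarrow> real \<Rightarrow> nat \<Rightarrow> (nat \<Rightarrow> 'x) \<Rightarrow> real ^ 'p \<Rightarrow> real" where
  "Lq_likelihood f q n xs \<theta> = (\<Sum>i<n. Lq q (f (xs i) \<theta>))"

definition Lq_maximizers ::
    "('x \<Rightarrow> real ^ 'p \<Rightarrow> real) \<Rightarrow> (real ^ 'p) set \<Rightarrow> real \<Rightarrow> nat \<Rightarrow> (nat \<Rightarrow> 'x) \<Rightarrow> (real ^ 'p) set" where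
  "Lq_maximizers f Theta q n xs = {\<theta>. is_arg_max (Lq_likelihood f q n xs) (\<lambda>t. t \<in> Theta) \<theta>}"

(* Theta may touch the boundary of the natural parameter space, where the log-partition function
   has no gradient and the score is undefined. Intersecting with the interior of the natural
   parameter space keeps exactly the parameters at which the score is a genuine gradient. *)
definition Lq_equation_solutions ::
    "'x measure \<Rightarrow> ('x \<Rightarrow> real ^ 'p) \<Rightarrow> (real ^ 'p) set \<Rightarrow> real \<Rightarrow> nat \<Rightarrow> (nat \<Rightarrow> 'x)
      \<Rightarrow> (real ^ 'p) set" where
  "Lq_equation_solutions \<mu> b Theta q n xs =
     {\<theta> \<in> Theta \<inter> interior (natural_space \<mu> b).
        (\<Sum>i<n. modified_score (expfam_density \<mu> b) (xs i) \<theta> q) = 0}"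

(* E n holds with probability going to 1. The inner events B n make this meaningful without
   measurability of E n; if the sets {w. E n w} are events, it says that their probabilities
   tend to 1. *)
definition with_prob_to_1 :: "'w measure \<Rightarrow> (nat \<Rightarrow> 'w \<Rightarrow> bool) \<Rightarrow> bool" where
  "with_prob_to_1 P E \<longleftrightarrow>
     (\<exists>B. (\<forall>n. B n \<in> sets P \<and> (\<forall>w\<in>B n. E n w)) \<and> (\<lambda>n. measure P (B n)) \<longlonglongrightarrow> 1)"

(* convergence in probability; no measurability of the T n is presupposed *)
definition converges_in_prob ::
    "'w measure \<Rightarrow> (nat \<Rightarrow> 'w \<Rightarrow> 'a::metric_space) \<Rightarrow> 'a \<Rightarrow> bool" where
  "converges_in_prob P T l \<longleftrightarrow> (\<forall>\<epsilon>>0. with_prob_to_1 P (\<lambda>n w. dist (T n w) l < \<epsilon>))"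

end

theory Submission
  imports Defs
begin

text \<open>
  Why the theorem holds. Write \<open>A\<close> for the log-partition function, whose gradient at an interior
  parameter \<open>\<theta>\<close> is the mean \<open>m(\<theta>)\<close> of \<open>b\<close> under the density \<open>f(\<cdot>;\<theta>)\<close>. In an exponential family
  \<open>f(x;\<theta>) powr (1-q) = exp((1-q)(\<theta> \<bullet> b(x) - A(\<theta>)))\<close>, so the factor containing \<open>A\<close> comes out of the sum over
  the sample. With the empirical cumulant function \<open>K(\<eta>) = ln (1/n \<Sum> exp(\<eta> \<bullet> b(X\<^sub>i)))\<close> and
  \<open>H(\<theta>) = K((1-q)\<theta>) / (1-q)\<close> (for \<open>q = 1\<close>, the inner product of \<open>\<theta>\<close> with the sample mean of \<open>b\<close>), the Lq-likelihood
  becomes a strictly increasing function of \<open>H - A\<close> (\<open>Lq_likelihood_eq\<close>), and the Lq-likelihood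
  equation becomes \<open>\<nabla>K((1-q)\<theta>) = m(\<theta>)\<close>, which says that \<open>H - A\<close> is stationary
  (\<open>Lq_equation_solutions_eq\<close>). The vector \<open>\<nabla>K(\<eta>)\<close> is the mean of the sample under exponentially
  tilted weights.

  Three facts then give the result.

  The function \<open>A\<close> lies above its tangents, and near \<open>\<theta>\<^sub>0\<close> it exceeds them by a fixed multiple of
  the squared distance (\<open>log_partition_strongly_convex_near\<close>). Full rank enters here: the excess is
  bounded below by a quadratic form that vanishes only on affine relations among the \<open>b\<^sub>j\<close>.

  The tilted mean is Lipschitz in \<open>\<eta>\<close> near \<open>0\<close>, with a constant depending only on \<open>r\<close> and a bound for
  the sample average of \<open>exp(r |b|)\<close> (\<open>tilted_mean_Lipschitz\<close>). Hence, for \<open>q\<close> near \<open>1\<close>, the gradient of \<open>H\<close>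
  on a ball containing the compact set is uniformly close to the sample mean of \<open>b\<close> and has an
  arbitrarily small Lipschitz constant.

  Since \<open>\<theta>\<^sub>0\<close> is interior to the natural parameter space, \<open>b\<close> has exponential moments under
  \<open>f(\<cdot>;\<theta>\<^sub>0)\<close>. By the weak law of large numbers, with probability tending to one, the sample mean of
  \<open>b\<close> is close to \<open>m(\<theta>\<^sub>0)\<close> and the average of \<open>exp(r |b|)\<close> is bounded (\<open>typical_sample\<close>).

  The rest is deterministic (\<open>unique_critical_point_and_maximizer\<close>). For the linear function
  \<open>H(\<theta>) = m(\<theta>\<^sub>0) \<bullet> \<theta>\<close>, the point \<open>\<theta>\<^sub>0\<close> is the unique critical point and maximizer of \<open>H - A\<close>. Passing to
  a function \<open>H\<close> with the gradient described above moves this point within a prescribed ball around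
  \<open>\<theta>\<^sub>0\<close> and preserves uniqueness and maximality. The radius of the ball is arbitrary, which gives
  consistency.
\<close>

section \<open>Events with probability tending to one and the weak law\<close>

lemma with_prob_to_1_mono:
  assumes "with_prob_to_1 P E" "\<And>n w. w \<in> space P \<Longrightarrow> E n w \<Longrightarrow> F n w"
  shows "with_prob_to_1 P F"
proof -
  obtain B where "\<forall>n. B n \<in> sets P \<and> (\<forall>w\<in>B n. E n w)" "(\<lambda>n. measure P (B n)) \<longlonglongrightarrow> 1"
    using assms(1) unfolding with_prob_to_1_def by auto
  moreover have "w \<in> space P" if "w \<in> B n" for n w
    using that calculation(1) sets.sets_into_space by blast
  ultimately show ?thesis
    unfolding with_prob_to_1_def using assms(2) by (intro exI[of _ B]) auto
qed

text \<open>
  Along the finitely many exceptional \<open>n\<close> the witnessing events are replaced by the empty set,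
  which does not affect the limit.
\<close>

lemma with_prob_to_1_eventually:
  assumes "with_prob_to_1 P E" "\<forall>\<^sub>F n in sequentially. \<forall>w\<in>space P. E n w \<longrightarrow> F n w"
  shows "with_prob_to_1 P F"
proof -
  obtain B where B: "\<forall>n. B n \<in> sets P \<and> (\<forall>w\<in>B n. E n w)" "(\<lambda>n. measure P (B n)) \<longlonglongrightarrow> 1"
    using assms(1) unfolding with_prob_to_1_def by auto
  let ?B = "\<lambda>n. if \<forall>w\<in>space P. E n w \<longrightarrow> F n w then B n else {}"
  have ev: "\<forall>\<^sub>F n in sequentially. measure P (?B n) = measure P (B n)"
    using assms(2) by eventually_elim simp
  have "(\<lambda>n. measure P (?B n)) \<longlonglongrightarrow> 1"
    using B(2) tendsto_cong[OF ev] by blast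
  moreover have "w \<in> space P" if "w \<in> B n" for n w
    using that B(1) sets.sets_into_space by blast
  then have "\<forall>n. ?B n \<in> sets P \<and> (\<forall>w\<in>?B n. F n w)"
    using B(1) by auto
  ultimately show ?thesis unfolding with_prob_to_1_def by (intro exI[of _ ?B] conjI)
qed

context prob_space
begin

lemma with_prob_to_1_True: "with_prob_to_1 M (\<lambda>n w. True)"
  unfolding with_prob_to_1_def by (intro exI[of _ "\<lambda>n. space M"]) (simp add: prob_space)

lemma with_prob_to_1_conj:
  assumes "with_prob_to_1 M E" "with_prob_to_1 M F"
  shows "with_prob_to_1 M (\<lambda>n w. E n w \<and> F n w)"
proof -
  obtain B where B: "\<forall>n. B n \<in> events \<and> (\<forall>w\<in>B n. E n w)" "(\<lambda>n. prob (B n)) \<longlonglongrightarrow> 1"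
    using assms(1) unfolding with_prob_to_1_def by auto
  obtain C where C: "\<forall>n. C n \<in> events \<and> (\<forall>w\<in>C n. F n w)" "(\<lambda>n. prob (C n)) \<longlonglongrightarrow> 1"
    using assms(2) unfolding with_prob_to_1_def by auto
  have "(\<lambda>n. prob (B n \<inter> C n)) \<longlonglongrightarrow> 1"
  proof (rule tendsto_sandwich)
    show "\<forall>\<^sub>F n in sequentially. prob (B n) + prob (C n) - 1 \<le> prob (B n \<inter> C n)"
    proof (intro always_eventually allI)
      fix n
      have "prob (B n \<union> C n) = prob (B n) + prob (C n) - prob (B n \<inter> C n)"
        using B C by (intro measure_Un3) (auto simp: fmeasurable_eq_sets)
      then show "prob (B n) + prob (C n) - 1 \<le> prob (B n \<inter> C n)"
        using prob_le_1[of "B n \<union> C n"] by linarith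
    qed
    show "(\<lambda>n. prob (B n) + prob (C n) - 1) \<longlonglongrightarrow> 1"
      using tendsto_diff[OF tendsto_add[OF B(2) C(2)] tendsto_const[of 1]] by simp
    show "\<forall>\<^sub>F n in sequentially. prob (B n \<inter> C n) \<le> 1" by simp
    show "(\<lambda>n. 1::real) \<longlonglongrightarrow> 1" by simp
  qed
  then show ?thesis
    unfolding with_prob_to_1_def using B(1) C(1)
    by (intro exI[of _ "\<lambda>n. B n \<inter> C n"]) auto
qed

lemma with_prob_to_1_ball:
  assumes "finite I" "\<And>i. i \<in> I \<Longrightarrow> with_prob_to_1 M (E i)"
  shows "with_prob_to_1 M (\<lambda>n w. \<forall>i\<in>I. E i n w)"
  using assms
proof (induction I rule: finite_induct)
  case empty then show ?case by (simp add: with_prob_to_1_True)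
next
  case (insert i I)
  then have "with_prob_to_1 M (\<lambda>n w. E i n w \<and> (\<forall>i\<in>I. E i n w))"
    by (intro with_prob_to_1_conj) auto
  then show ?case by simp
qed

text \<open>
  The cross term in the induction step is the expectation of a product of two independent centred
  variables, the new summand and the partial sum.
\<close>

lemma indep_variance_sum:
  fixes Y :: "nat \<Rightarrow> 'a \<Rightarrow> real"
  assumes indep: "indep_vars (\<lambda>_. borel) Y UNIV"
    and int: "\<And>i. integrable M (Y i)" and sq: "\<And>i. integrable M (\<lambda>w. (Y i w)\<^sup>2)"
    and mean: "\<And>i. expectation (Y i) = 0" and var: "\<And>i. expectation (\<lambda>w. (Y i w)\<^sup>2) = v"
  shows "integrable M (\<lambda>w. (\<Sum>i<n. Y i w)\<^sup>2) \<and> expectation (\<lambda>w. (\<Sum>i<n. Y i w)\<^sup>2) = n * v"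
proof (induction n)
  case 0 then show ?case by simp
next
  case (Suc n)
  have "indep_var borel (Y n) borel (\<lambda>w. \<Sum>i\<in>{..<n}. Y i w)"
    by (rule indep_vars_sum) (auto intro: indep_vars_subset[OF indep])
  note pr = indep_var_integrable[OF this] indep_var_lebesgue_integral[OF this]
  have ints: "integrable M (\<lambda>w. \<Sum>i<n. Y i w)" by (intro Bochner_Integration.integrable_sum int)
  have p1: "integrable M (\<lambda>w. Y n w * (\<Sum>i<n. Y i w))" using pr(1)[OF int ints] .
  have p2: "expectation (\<lambda>w. Y n w * (\<Sum>i<n. Y i w)) = 0"
    using pr(2)[OF int ints] mean[of n] by simp
  have e: "(\<Sum>i<Suc n. Y i w)\<^sup>2
      = (\<Sum>i<n. Y i w)\<^sup>2 + (2 * (Y n w * (\<Sum>i<n. Y i w)) + (Y n w)\<^sup>2)" for w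
    by (simp add: power2_eq_square algebra_simps)
  show ?case
    unfolding e using Suc.IH p1 p2 sq[of n] var[of n] by (simp add: algebra_simps)
qed

lemma weak_law_of_large_numbers:
  fixes Y :: "nat \<Rightarrow> 'a \<Rightarrow> real"
  assumes indep: "indep_vars (\<lambda>_. borel) Y UNIV"
    and int: "\<And>i. integrable M (Y i)" and sq: "\<And>i. integrable M (\<lambda>w. (Y i w)\<^sup>2)"
    and mean: "\<And>i. expectation (Y i) = c" and var: "\<And>i. expectation (\<lambda>w. (Y i w)\<^sup>2) = v"
    and \<epsilon>: "0 < \<epsilon>"
  shows "with_prob_to_1 M (\<lambda>n w. \<bar>(\<Sum>i<n. Y i w) / n - c\<bar> < \<epsilon>)"
proof -
  define Z where "Z i w = Y i w - c" for i w
  have Zi: "indep_vars (\<lambda>_. borel) Z UNIV"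
    using indep_vars_compose2[OF indep, of "\<lambda>i y. y - c" "\<lambda>_. borel"] by (simp add: Z_def[abs_def])
  have ZI: "integrable M (Z i)" for i using int by (simp add: Z_def[abs_def])
  have Zsq: "(Z i w)\<^sup>2 = (Y i w)\<^sup>2 - 2 * c * Y i w + c\<^sup>2" for i w
    by (simp add: Z_def power2_eq_square algebra_simps)
  have Z2: "integrable M (\<lambda>w. (Z i w)\<^sup>2)" for i unfolding Zsq using int sq by simp
  have Zm: "expectation (Z i) = 0" for i using int mean by (simp add: Z_def[abs_def] prob_space)
  have Zv: "expectation (\<lambda>w. (Z i w)\<^sup>2) = v - c\<^sup>2" for i
    unfolding Zsq using int sq mean var by (simp add: prob_space power2_eq_square)
  define S where "S n w = (\<Sum>i<n. Z i w)" for n w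
  note vS = indep_variance_sum[OF Zi ZI Z2 Zm Zv, folded S_def]
  have Sm [measurable]: "S n \<in> borel_measurable M" for n
    unfolding S_def[abs_def] using ZI by (intro borel_measurable_sum) auto
  define B where "B n = {w \<in> space M. \<bar>S n w\<bar> < n * \<epsilon>}" for n
  have Bm: "B n \<in> events" for n unfolding B_def by measurable
  have lim: "(\<lambda>n. prob (B n)) \<longlonglongrightarrow> 1"
  proof (rule tendsto_sandwich)
    have "1 - ((v - c\<^sup>2) / \<epsilon>\<^sup>2) / n \<le> prob (B n)" if "n > 0" for n
    proof -
      have n\<epsilon>: "0 < n * \<epsilon>" using that \<epsilon> by simp
      have "prob {w \<in> space M. \<bar>S n w - expectation (S n)\<bar> \<ge> n * \<epsilon>} \<le> variance (S n) / (n * \<epsilon>)\<^sup>2"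
        using vS[of n] n\<epsilon> by (intro Chebyshev_inequality) auto
      moreover have "expectation (S n) = 0"
        using ZI Zm by (simp add: S_def[abs_def])
      ultimately have "prob {w \<in> space M. \<bar>S n w\<bar> \<ge> n * \<epsilon>} \<le> n * (v - c\<^sup>2) / (n * \<epsilon>)\<^sup>2"
        using vS[of n] by simp
      also have "n * (v - c\<^sup>2) / (n * \<epsilon>)\<^sup>2 = ((v - c\<^sup>2) / \<epsilon>\<^sup>2) / n"
        using that by (simp add: power2_eq_square)
      finally have "prob {w \<in> space M. \<bar>S n w\<bar> \<ge> n * \<epsilon>} \<le> ((v - c\<^sup>2) / \<epsilon>\<^sup>2) / n" .
      moreover have "{w \<in> space M. \<bar>S n w\<bar> \<ge> n * \<epsilon>} = space M - B n"
        by (auto simp: B_def)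
      ultimately show ?thesis using prob_compl[OF Bm, of n] by simp
    qed
    then show "\<forall>\<^sub>F n in sequentially. 1 - ((v - c\<^sup>2) / \<epsilon>\<^sup>2) / n \<le> prob (B n)"
      by (rule eventually_mono[OF eventually_gt_at_top[of "0::nat"]])
    show "(\<lambda>n. 1 - ((v - c\<^sup>2) / \<epsilon>\<^sup>2) / real n) \<longlonglongrightarrow> 1"
      using tendsto_diff[OF tendsto_const[of "1::real"] lim_const_over_n[of "(v - c\<^sup>2) / \<epsilon>\<^sup>2"]]
      by simp
  qed auto
  have "\<bar>(\<Sum>i<n. Y i w) / n - c\<bar> < \<epsilon>" if "w \<in> B n" for n w
  proof -
    have n: "n > 0" using that by (cases n) (auto simp: B_def S_def)
    have "(\<Sum>i<n. Y i w) / n - c = S n w / n"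
      using n by (simp add: S_def Z_def sum_subtractf field_simps)
    then show ?thesis using that n by (simp add: B_def field_simps)
  qed
  then show ?thesis
    unfolding with_prob_to_1_def using Bm lim by (intro exI[of _ B]) auto
qed

end

section \<open>Stability of critical points under small perturbations\<close>

lemma GDERIV_unique:
  assumes "GDERIV f x :> D" "GDERIV f x :> D'"
  shows "D = D'"
proof -
  have "(\<lambda>h. h \<bullet> D) = (\<lambda>h. h \<bullet> D')"
    using assms has_derivative_unique unfolding gderiv_def by blast
  then show ?thesis
    by (metis inner_commute vector_eq_rdot)
qed

lemma GDERIV_mean_value:
  fixes f :: "'a::real_inner \<Rightarrow> real"
  assumes "convex C" "x \<in> C" "y \<in> C" "\<And>z. z \<in> C \<Longrightarrow> GDERIV f z :> g z"
  obtains z where "z \<in> C" "f y - f x = g z \<bullet> (y - x)"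
proof -
  let ?p = "\<lambda>t::real. x + t *\<^sub>R (y - x)"
  have inC: "?p t \<in> C" if "0 \<le> t" "t \<le> 1" for t
    using convexD_alt[OF assms(1-3) that] by (simp add: algebra_simps)
  have d: "DERIV (\<lambda>t. f (?p t)) t :> g (?p t) \<bullet> (y - x)" if "0 \<le> t" "t \<le> 1" for t
  proof -
    have "(?p has_derivative (\<lambda>s. s *\<^sub>R (y - x))) (at t)"
      by (auto intro!: derivative_eq_intros)
    from has_derivative_compose[OF this] assms(4)[OF inC[OF that], unfolded gderiv_def]
    have "((\<lambda>t. f (?p t)) has_derivative (\<lambda>s. (s *\<^sub>R (y - x)) \<bullet> g (?p t))) (at t)" by blast
    then show ?thesis
      unfolding has_field_derivative_def
      by (rule has_derivative_eq_rhs) (auto simp: inner_commute mult.commute)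
  qed
  from MVT2[of 0 1 "\<lambda>t. f (?p t)" "\<lambda>t. g (?p t) \<bullet> (y - x)"] d
  obtain t where "0 < t" "t < 1" "f (?p 1) - f (?p 0) = (1 - 0) * (g (?p t) \<bullet> (y - x))"
    by auto
  then show ?thesis using that[of "?p t"] inC[of t] by auto
qed

text \<open>
  A stability statement for critical points and maximizers. With \<open>h\<close> constantly equal
  to \<open>m c\<close>, the point \<open>c\<close> is the unique critical point and maximizer of \<open>H - A\<close>. Closeness of \<open>h\<close> to
  \<open>m c\<close> cannot compensate for the growth of \<open>A\<close> outside the ball around \<open>c\<close>, so all critical points
  and maximizers lie inside. There \<open>m\<close> is strongly monotone, with modulus \<open>2 \<kappa>\<close>, whereas \<open>h\<close> has a
  smaller Lipschitz constant, so \<open>h - m\<close> has at most one zero.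

  The set \<open>Theta\<close> may be neither convex nor connected, and \<open>A\<close> is differentiable only on \<open>D\<close>, which
  need not contain \<open>Theta\<close>. Thus \<open>A\<close> is controlled through tangents at points of \<open>D\<close> only. The mean
  value theorem is applied to \<open>H\<close>, on the larger convex set \<open>C\<close>.
\<close>

lemma unique_critical_point_and_maximizer:
  fixes A H :: "'a::euclidean_space \<Rightarrow> real" and m h :: "'a \<Rightarrow> 'a"
  assumes \<delta>: "0 < \<delta>" and ball_Theta: "cball c \<delta> \<subseteq> Theta" and ball_D: "cball c \<delta> \<subseteq> D"
    and C: "convex C" "Theta \<subseteq> C"
    and gradA: "\<And>\<theta>. \<theta> \<in> D \<Longrightarrow> GDERIV A \<theta> :> m \<theta>"
    and subgrad: "\<And>\<theta> \<theta>'. \<theta> \<in> D \<Longrightarrow> \<theta>' \<in> Theta \<Longrightarrow> A \<theta>' \<ge> A \<theta> + m \<theta> \<bullet> (\<theta>' - \<theta>)"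
    and strong: "\<And>\<theta> \<theta>'. \<theta> \<in> cball c \<delta> \<Longrightarrow> \<theta>' \<in> cball c \<delta> \<Longrightarrow>
                   A \<theta>' \<ge> A \<theta> + m \<theta> \<bullet> (\<theta>' - \<theta>) + \<kappa> * (norm (\<theta>' - \<theta>))\<^sup>2"
    and gradH: "\<And>\<theta>. \<theta> \<in> C \<Longrightarrow> GDERIV H \<theta> :> h \<theta>"
    and close: "\<And>\<theta>. \<theta> \<in> C \<Longrightarrow> norm (h \<theta> - m c) < \<kappa> * \<delta>"
    and lip: "\<And>\<theta> \<theta>'. \<theta> \<in> C \<Longrightarrow> \<theta>' \<in> C \<Longrightarrow> norm (h \<theta> - h \<theta>') \<le> L * norm (\<theta> - \<theta>')"
    and L: "L < 2 * \<kappa>"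
  obtains \<theta> where "\<theta> \<in> ball c \<delta>" "{\<theta> \<in> Theta \<inter> D. h \<theta> = m \<theta>} = {\<theta>}"
    "{\<theta>. is_arg_max (\<lambda>\<theta>. H \<theta> - A \<theta>) (\<lambda>t. t \<in> Theta) \<theta>} = {\<theta>}"
proof -
  have inTheta: "x \<in> Theta" and inD: "x \<in> D" and inC: "x \<in> C" if "x \<in> cball c \<delta>" for x
    using that ball_Theta ball_D C(2) by blast+
  have c: "c \<in> cball c \<delta>" using \<delta> by simp
  note c = c inTheta[OF c] inD[OF c] inC[OF c]
  \<comment> \<open>The quadratic gain at the point where the segment from \<open>c\<close> to \<open>\<theta>\<close> leaves the ball persists as a
     linear gain beyond it, because \<open>A\<close> lies above its tangent at that point.\<close>
  have growth: "A \<theta> \<ge> A c + m c \<bullet> (\<theta> - c) + \<kappa> * \<delta> * norm (\<theta> - c)"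
    if \<theta>: "\<theta> \<in> Theta" "\<delta> \<le> norm (\<theta> - c)" for \<theta>
  proof -
    define s where "s = norm (\<theta> - c) / \<delta>"
    define p where "p = c + (1 / s) *\<^sub>R (\<theta> - c)"
    have s: "s \<ge> 1" using \<theta> \<delta> by (simp add: s_def)
    then have "s > 0" by simp
    have np: "norm (p - c) = \<delta>"
      using \<theta> \<delta> by (auto simp: p_def s_def)
    have pc: "p \<in> cball c \<delta>" using np by (simp add: dist_norm norm_minus_commute)
    then have pD: "p \<in> D" using ball_D by auto
    have e1: "\<theta> - c = s *\<^sub>R (p - c)" using \<open>s > 0\<close> by (simp add: p_def)
    then have e2: "\<theta> - p = (s - 1) *\<^sub>R (p - c)" by (simp add: algebra_simps)
    have 1: "A p \<ge> A c + m c \<bullet> (p - c) + \<kappa> * \<delta>\<^sup>2"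
      using strong[OF c(1) pc] np by simp
    have 2: "m p \<bullet> (p - c) \<ge> A p - A c"
      using subgrad[OF pD c(2)] by (simp add: inner_diff_right)
    have "A \<theta> \<ge> A p + m p \<bullet> (\<theta> - p)" using subgrad[OF pD \<theta>(1)] .
    also have "m p \<bullet> (\<theta> - p) = (s - 1) * (m p \<bullet> (p - c))" by (simp add: e2)
    finally have "A \<theta> \<ge> A p + (s - 1) * (m p \<bullet> (p - c))" .
    moreover have "(s - 1) * (m p \<bullet> (p - c)) \<ge> (s - 1) * (A p - A c)"
      using 2 s by (intro mult_left_mono) auto
    moreover have "s * (A p - A c) \<ge> s * (m c \<bullet> (p - c) + \<kappa> * \<delta>\<^sup>2)"
      using 1 s by (intro mult_left_mono) auto
    moreover have "s * (m c \<bullet> (p - c)) = m c \<bullet> (\<theta> - c)" by (simp add: e1)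
    moreover have "s * (\<kappa> * \<delta>\<^sup>2) = \<kappa> * \<delta> * norm (\<theta> - c)"
      using \<delta> by (simp add: s_def power2_eq_square)
    ultimately show ?thesis unfolding left_diff_distrib distrib_left right_diff_distrib by linarith
  qed
  have crit_inside: "\<theta> \<in> ball c \<delta>" if \<theta>: "\<theta> \<in> Theta" "\<theta> \<in> D" "h \<theta> = m \<theta>" for \<theta>
  proof (rule ccontr)
    assume "\<theta> \<notin> ball c \<delta>"
    then have far: "\<delta> \<le> norm (\<theta> - c)" by (simp add: dist_norm norm_minus_commute)
    have "m \<theta> \<bullet> (\<theta> - c) \<ge> A \<theta> - A c"
      using subgrad[OF \<theta>(2) c(2)] by (simp add: inner_diff_right)
    with growth[OF \<theta>(1) far] \<theta>(3)
    have "\<kappa> * \<delta> * norm (\<theta> - c) \<le> (h \<theta> - m c) \<bullet> (\<theta> - c)"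
      by (simp add: inner_diff_left)
    also have "\<dots> \<le> norm (h \<theta> - m c) * norm (\<theta> - c)" by (rule norm_cauchy_schwarz)
    also have "\<dots> < \<kappa> * \<delta> * norm (\<theta> - c)"
      using close[of \<theta>] \<theta>(1) C(2) far \<delta> by (intro mult_strict_right_mono) auto
    finally show False by simp
  qed
  have crit_unique: "\<theta> = \<theta>'"
    if "\<theta> \<in> cball c \<delta>" "\<theta>' \<in> cball c \<delta>" "h \<theta> = m \<theta>" "h \<theta>' = m \<theta>'" for \<theta> \<theta>'
  proof (rule ccontr)
    assume ne: "\<theta> \<noteq> \<theta>'"
    have "2 * \<kappa> * (norm (\<theta> - \<theta>'))\<^sup>2 \<le> (m \<theta> - m \<theta>') \<bullet> (\<theta> - \<theta>')"
      using strong[OF that(1,2)] strong[OF that(2,1)]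
      by (simp add: algebra_simps norm_minus_commute)
    also have "\<dots> \<le> norm (h \<theta> - h \<theta>') * norm (\<theta> - \<theta>')"
      using norm_cauchy_schwarz that by metis
    also have "\<dots> \<le> L * norm (\<theta> - \<theta>') * norm (\<theta> - \<theta>')"
      using lip[OF inC[OF that(1)] inC[OF that(2)]] by (intro mult_right_mono) simp_all
    also have "\<dots> < 2 * \<kappa> * (norm (\<theta> - \<theta>'))\<^sup>2"
      using L ne by (simp add: power2_eq_square)
    finally show False by simp
  qed
  have max_inside: "H \<theta> - A \<theta> < H c - A c"
    if \<theta>: "\<theta> \<in> Theta" "\<theta> \<notin> ball c \<delta>" for \<theta>
  proof -
    have far: "\<delta> \<le> norm (\<theta> - c)" using \<theta>(2) by (simp add: dist_norm norm_minus_commute)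
    obtain z where z: "z \<in> C" "H \<theta> - H c = h z \<bullet> (\<theta> - c)"
      using GDERIV_mean_value[OF C(1) c(4) _ gradH] \<theta>(1) C(2) by blast
    have "(h z - m c) \<bullet> (\<theta> - c) \<le> norm (h z - m c) * norm (\<theta> - c)"
      by (rule norm_cauchy_schwarz)
    also have "\<dots> < \<kappa> * \<delta> * norm (\<theta> - c)"
      using close[OF z(1)] far \<delta> by (intro mult_strict_right_mono) auto
    finally show ?thesis using growth[OF \<theta>(1) far] z(2) by (simp add: inner_diff_left)
  qed
  let ?G = "\<lambda>\<theta>. H \<theta> - A \<theta>"
  have dG: "GDERIV ?G \<theta> :> h \<theta> - m \<theta>" if "\<theta> \<in> cball c \<delta>" for \<theta>
    using gradA[OF inD[OF that]] gradH[OF inC[OF that]] by (intro GDERIV_diff)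
  have max_crit: "\<theta> \<in> ball c \<delta> \<and> h \<theta> = m \<theta>"
    if max: "is_arg_max ?G (\<lambda>t. t \<in> Theta) \<theta>" for \<theta>
  proof -
    have \<theta>: "\<theta> \<in> Theta" "\<And>y. y \<in> Theta \<Longrightarrow> ?G y \<le> ?G \<theta>"
      using max by (auto simp: is_arg_max_def not_less)
    then have inb: "\<theta> \<in> ball c \<delta>" using max_inside[of \<theta>] c(2) by force
    have "(?G has_derivative (\<lambda>v. v \<bullet> (h \<theta> - m \<theta>))) (at \<theta>)"
      using dG[of \<theta>] inb unfolding gderiv_def by auto
    moreover have "\<forall>y\<in>ball c \<delta>. ?G y \<le> ?G \<theta>" using \<theta>(2) inTheta by simp
    ultimately have "(\<lambda>v. v \<bullet> (h \<theta> - m \<theta>)) = (\<lambda>v. 0)"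
      using differential_zero_maxmin[OF inb open_ball] by blast
    from fun_cong[OF this, of "h \<theta> - m \<theta>"] show ?thesis using inb by simp
  qed
  have "continuous_on (cball c \<delta>) ?G"
    using dG unfolding gderiv_def
    by (meson continuous_at_imp_continuous_on has_derivative_continuous)
  then obtain t where t: "t \<in> cball c \<delta>" "\<And>y. y \<in> cball c \<delta> \<Longrightarrow> ?G y \<le> ?G t"
    using continuous_attains_sup[of "cball c \<delta>" ?G] \<delta> by auto
  have tmax: "is_arg_max ?G (\<lambda>t. t \<in> Theta) t"
  proof -
    have "?G y \<le> ?G t" if "y \<in> Theta" for y
    proof (cases "y \<in> ball c \<delta>")
      case True then show ?thesis using t(2) by auto
    next
      case False
      then show ?thesis using max_inside[OF that False] t(2)[OF c(1)] by linarith
    qed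
    then show ?thesis using t(1) ball_Theta by (auto simp: is_arg_max_def not_less)
  qed
  have tc: "t \<in> ball c \<delta>" "h t = m t" using max_crit[OF tmax] by auto
  show ?thesis
  proof (rule that[OF tc(1)])
    have "\<theta> = t" if "\<theta> \<in> ball c \<delta>" "h \<theta> = m \<theta>" for \<theta>
      using crit_unique[of \<theta> t] that t(1) tc(2) by simp
    then show "{\<theta> \<in> Theta \<inter> D. h \<theta> = m \<theta>} = {t}"
      "{\<theta>. is_arg_max ?G (\<lambda>t. t \<in> Theta) \<theta>} = {t}"
      using crit_inside max_crit tmax tc(2) inTheta[OF t(1)] inD[OF t(1)] by blast+
  qed
qed

section \<open>Exponential estimates and positive definite forms\<close>

lemma exp_diff_le:
  fixes s t c :: real
  assumes "s \<le> c" "t \<le> c"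
  shows "\<bar>exp s - exp t\<bar> \<le> \<bar>s - t\<bar> * exp c"
proof -
  have main: "exp x - exp y \<le> \<bar>x - y\<bar> * exp c" if "x \<le> c" for x y :: real
  proof -
    have "exp x * (1 + (y - x)) \<le> exp x * exp (y - x)"
      by (intro mult_left_mono exp_ge_add_one_self) auto
    then have "exp x - exp y \<le> (x - y) * exp x"
      by (simp add: algebra_simps flip: exp_add)
    also have "\<dots> \<le> \<bar>x - y\<bar> * exp c"
      using that by (intro mult_mono) auto
    finally show ?thesis .
  qed
  from main[OF assms(1), of t] main[OF assms(2), of s] show ?thesis by (simp add: abs_minus_commute)
qed

lemma exp_minus_linear_bounds:
  fixes t :: real
  shows "exp t - 1 - t \<le> t\<^sup>2 * exp \<bar>t\<bar>" and "t\<^sup>2 / 2 * exp (- \<bar>t\<bar>) \<le> exp t - 1 - t"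
proof -
  obtain s where s: "\<bar>s\<bar> \<le> \<bar>t\<bar>" "exp t = 1 + t + exp s / 2 * t\<^sup>2"
    using Maclaurin_exp_le[of t 2] by (auto simp: eval_nat_numeral)
  have "exp s \<le> exp \<bar>t\<bar>" "exp (- \<bar>t\<bar>) \<le> exp s" using s(1) by auto
  then have "exp s / 2 \<le> exp \<bar>t\<bar>" "exp (- \<bar>t\<bar>) / 2 \<le> exp s / 2"
    using exp_gt_zero[of "\<bar>t\<bar>"] by linarith+
  then have "exp s / 2 * t\<^sup>2 \<le> exp \<bar>t\<bar> * t\<^sup>2" "exp (- \<bar>t\<bar>) / 2 * t\<^sup>2 \<le> exp s / 2 * t\<^sup>2"
    by (intro mult_right_mono; simp)+
  then show "exp t - 1 - t \<le> t\<^sup>2 * exp \<bar>t\<bar>" "t\<^sup>2 / 2 * exp (- \<bar>t\<bar>) \<le> exp t - 1 - t"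
    using s(2) by (simp_all add: mult.commute)
qed

lemma power_le_exp:
  fixes y s :: real
  assumes "0 \<le> y" "0 < s"
  shows "y \<le> exp (s * y) / s" and "y\<^sup>2 \<le> 4 / s\<^sup>2 * exp (s * y)"
proof -
  have 1: "s * y \<le> exp (s * y)" for s :: real using exp_ge_add_one_self[of "s * y"] by linarith
  then show "y \<le> exp (s * y) / s" using assms by (simp add: field_simps)
  have "(s / 2 * y)\<^sup>2 \<le> (exp (s / 2 * y))\<^sup>2" using 1[of "s / 2"] assms by (intro power_mono) simp_all
  also have "\<dots> = exp (s * y)" by (simp add: power2_eq_square flip: exp_add)
  finally show "y\<^sup>2 \<le> 4 / s\<^sup>2 * exp (s * y)"
    using assms by (simp add: field_simps power2_eq_square)
qed

text \<open>
  Some coordinate of \<open>v\<close> has absolute value at least \<open>norm v\<close> divided by the dimension. This reduces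
  exponential moments of the norm to those of finitely many linear functionals.
\<close>

lemma exp_norm_le_sum_exp:
  fixes v :: "'a::euclidean_space"
  assumes "0 \<le> r"
  shows "exp (r * norm v) \<le> (\<Sum>i\<in>Basis. exp (r * DIM('a) * (i \<bullet> v)) + exp (- (r * DIM('a) * (i \<bullet> v))))"
proof -
  have "\<exists>i\<in>Basis. norm v \<le> real (DIM('a)) * \<bar>v \<bullet> i\<bar>"
  proof (rule ccontr)
    assume "\<not> ?thesis"
    then have "(\<Sum>i\<in>(Basis::'a set). real (DIM('a)) * \<bar>v \<bullet> i\<bar>) < (\<Sum>i\<in>(Basis::'a set). norm v)"
      by (intro sum_strict_mono) auto
    then have "(\<Sum>i\<in>Basis. \<bar>v \<bullet> i\<bar>) < norm v" by (simp flip: sum_distrib_left)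
    with norm_le_l1[of v] show False by simp
  qed
  then obtain i where i: "i \<in> Basis" "norm v \<le> real (DIM('a)) * \<bar>v \<bullet> i\<bar>" by blast
  let ?t = "r * DIM('a) * (i \<bullet> v)"
  have "r * norm v \<le> r * (DIM('a) * \<bar>v \<bullet> i\<bar>)" using i assms by (intro mult_left_mono)
  also have "\<dots> = \<bar>?t\<bar>" using assms by (simp add: abs_mult inner_commute)
  finally have "exp (r * norm v) \<le> exp \<bar>?t\<bar>" by simp
  also have "\<dots> \<le> exp ?t + exp (- ?t)" by (cases "?t \<ge> 0") auto
  also have "\<dots> \<le> (\<Sum>i\<in>Basis. exp (r * DIM('a) * (i \<bullet> v)) + exp (- (r * DIM('a) * (i \<bullet> v))))"
    by (rule member_le_sum[OF i(1)]) (auto intro: add_nonneg_nonneg)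
  finally show ?thesis .
qed

lemma GDERIV_of_quadratic_error:
  assumes "0 < \<rho>" "\<And>h. norm h < \<rho> \<Longrightarrow> \<bar>f (x + h) - f x - h \<bullet> g\<bar> \<le> K * (norm h)\<^sup>2"
  shows "GDERIV f x :> g"
  unfolding gderiv_def has_derivative_at
proof
  show "bounded_linear (\<lambda>h. h \<bullet> g)" by (rule bounded_linear_inner_left)
  show "(\<lambda>h. norm (f (x + h) - f x - h \<bullet> g) / norm h) \<midarrow>0\<rightarrow> 0"
  proof (rule Lim_null_comparison)
    show "\<forall>\<^sub>F h in at 0. norm (norm (f (x + h) - f x - h \<bullet> g) / norm h) \<le> K * norm h"
      unfolding eventually_at
    proof (intro exI[of _ \<rho>] conjI ballI impI assms(1))
      fix h :: 'a assume "h \<noteq> 0 \<and> dist h 0 < \<rho>"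
      then show "norm (norm (f (x + h) - f x - h \<bullet> g) / norm h) \<le> K * norm h"
        using assms(2)[of h] by (simp add: divide_simps power2_eq_square mult.assoc)
    qed
    have "((\<lambda>h::'a. K * norm h) \<longlongrightarrow> K * norm (0::'a)) (at 0)" by (intro tendsto_intros)
    then show "((\<lambda>h::'a. K * norm h) \<longlongrightarrow> 0) (at 0)" by simp
  qed
qed

text \<open>
  The quadratic form is continuous, by dominated convergence, and vanishes nowhere on the unit
  sphere. Compactness of the sphere gives a positive lower bound there.
\<close>

lemma nondegenerate_quadratic_form_lower_bound:
  fixes \<beta> :: "'x \<Rightarrow> 'a::euclidean_space"
  assumes [measurable]: "\<beta> \<in> borel_measurable \<mu>" "\<omega> \<in> borel_measurable \<mu>"
    and \<omega>: "\<And>x. \<omega> x > 0" and int: "integrable \<mu> (\<lambda>x. \<omega> x * (norm (\<beta> x))\<^sup>2)"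
    and nondeg: "\<And>z. (AE x in \<mu>. z \<bullet> \<beta> x = 0) \<Longrightarrow> z = 0"
  obtains c where "c > 0" "\<And>z. (\<integral>x. \<omega> x * (z \<bullet> \<beta> x)\<^sup>2 \<partial>\<mu>) \<ge> c * (norm z)\<^sup>2"
proof -
  define Q where "Q z = (\<integral>x. \<omega> x * (z \<bullet> \<beta> x)\<^sup>2 \<partial>\<mu>)" for z
  have le: "\<omega> x * (z \<bullet> \<beta> x)\<^sup>2 \<le> (norm z)\<^sup>2 * (\<omega> x * (norm (\<beta> x))\<^sup>2)" for z x
  proof -
    have "(z \<bullet> \<beta> x)\<^sup>2 \<le> (norm z * norm (\<beta> x))\<^sup>2"
      using Cauchy_Schwarz_ineq2[of z "\<beta> x"] by (intro abs_le_square_iff[THEN iffD1]) simp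
    from mult_left_mono[OF this, of "\<omega> x"] \<omega>[of x] show ?thesis
      by (simp add: power_mult_distrib algebra_simps)
  qed
  have intQ: "integrable \<mu> (\<lambda>x. \<omega> x * (z \<bullet> \<beta> x)\<^sup>2)" for z
  proof (rule Bochner_Integration.integrable_bound[OF integrable_mult_right[OF int, of "(norm z)\<^sup>2"]])
    show "AE x in \<mu>. norm (\<omega> x * (z \<bullet> \<beta> x)\<^sup>2) \<le> norm ((norm z)\<^sup>2 * (\<omega> x * (norm (\<beta> x))\<^sup>2))"
      using le \<omega> by (intro AE_I2) (simp add: abs_mult less_imp_le abs_of_pos)
  qed measurable
  have cont: "continuous_on (sphere 0 1) Q"
  proof (rule continuous_on_sequentiallyI)
    fix u a assume u: "\<forall>n. u n \<in> sphere (0::'a) 1" "a \<in> sphere (0::'a) 1" "u \<longlonglongrightarrow> a"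
    show "(\<lambda>n. Q (u n)) \<longlonglongrightarrow> Q a"
      unfolding Q_def
    proof (rule integral_dominated_convergence[OF _ _ int])
      show "AE x in \<mu>. (\<lambda>n. \<omega> x * (u n \<bullet> \<beta> x)\<^sup>2) \<longlonglongrightarrow> \<omega> x * (a \<bullet> \<beta> x)\<^sup>2"
        using u(3) by (intro AE_I2 tendsto_intros)
      show "AE x in \<mu>. norm (\<omega> x * (u n \<bullet> \<beta> x)\<^sup>2) \<le> \<omega> x * (norm (\<beta> x))\<^sup>2" for n
        using le[of _ "u n"] u(1) \<omega> by (intro AE_I2) (simp add: abs_mult less_imp_le abs_of_pos)
    qed measurable
  qed
  have "sphere (0::'a) 1 \<noteq> {}" using nonempty_Basis norm_Basis by force
  then obtain z0 where z0: "norm z0 = 1" "\<And>z. norm z = 1 \<Longrightarrow> Q z0 \<le> Q z"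
    using continuous_attains_inf[OF compact_sphere _ cont] by auto
  have "Q z0 > 0"
  proof (rule ccontr)
    assume "\<not> Q z0 > 0"
    moreover have "Q z0 \<ge> 0" unfolding Q_def using \<omega> by (intro Bochner_Integration.integral_nonneg) (simp add: less_imp_le)
    ultimately have "Q z0 = 0" by simp
    then have "AE x in \<mu>. \<omega> x * (z0 \<bullet> \<beta> x)\<^sup>2 = 0"
      using integral_nonneg_eq_0_iff_AE[OF intQ, of z0] \<omega> by (simp add: Q_def less_imp_le)
    then have "AE x in \<mu>. z0 \<bullet> \<beta> x = 0"
      by eventually_elim (use \<omega> in \<open>metis less_irrefl mult_eq_0_iff power2_eq_square\<close>)
    from nondeg[OF this] z0(1) show False by simp
  qed
  moreover have "Q z \<ge> Q z0 * (norm z)\<^sup>2" for z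
  proof (cases "z = 0")
    case False
    have "Q z0 \<le> Q ((1 / norm z) *\<^sub>R z)" using False by (intro z0(2)) simp
    also have "\<dots> = (1 / norm z)\<^sup>2 * Q z"
      unfolding Q_def by (simp add: power_mult_distrib mult.left_commute power_divide flip: integral_mult_right_zero)
    finally show ?thesis using False by (simp add: field_simps power2_eq_square)
  qed (simp add: Q_def)
  ultimately show ?thesis using that[of "Q z0"] by (simp add: Q_def)
qed

section \<open>The log-partition function of a full-rank family\<close>

locale full_rank_exponential_family =
  fixes \<mu> :: "'x measure" and b :: "'x \<Rightarrow> real ^ 'p"
  assumes b_measurable [measurable]: "b \<in> borel_measurable \<mu>"
    and full_rank: "full_rank \<mu> b"
begin

abbreviation "N \<equiv> natural_space \<mu> b"
abbreviation "A \<equiv> log_partition \<mu> b"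

definition Z :: "real ^ 'p \<Rightarrow> real" where
  "Z \<theta> = (\<integral>x. exp (\<theta> \<bullet> b x) \<partial>\<mu>)"

definition mean :: "real ^ 'p \<Rightarrow> real ^ 'p" where
  "mean \<theta> = (1 / Z \<theta>) *\<^sub>R (\<integral>x. exp (\<theta> \<bullet> b x) *\<^sub>R b x \<partial>\<mu>)"

lemma affine_relation_trivial:
  assumes "AE x in \<mu>. v \<bullet> b x - c = 0" shows "v = 0 \<and> c = 0"
proof -
  have "AE x in \<mu>. (\<Sum>j\<in>UNIV. v $ j * b x $ j) + (- c) = 0"
    using assms by (simp add: inner_vec_def)
  then have "v = 0 \<and> - c = 0" using full_rank unfolding full_rank_def by blast
  then show ?thesis by simp
qed

text \<open>
  Full rank excludes the zero measure, since the relation \<open>0 \<bullet> b - 1 = 0\<close> would hold almost everywhere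
  for it.
\<close>

lemma integral_pos_of_pos:
  assumes "integrable \<mu> g" "\<And>x. g x > (0::real)" shows "(\<integral>x. g x \<partial>\<mu>) > 0"
proof -
  have "(\<integral>x. g x \<partial>\<mu>) \<noteq> 0"
  proof
    assume "(\<integral>x. g x \<partial>\<mu>) = 0"
    then have "AE x in \<mu>. g x = 0"
      using integral_nonneg_eq_0_iff_AE[OF assms(1)] assms(2) by (simp add: less_imp_le)
    then have "AE x in \<mu>. 0 \<bullet> b x - 1 = 0"
      by eventually_elim (use assms(2) in \<open>metis less_irrefl\<close>)
    from affine_relation_trivial[OF this] show False by simp
  qed
  moreover have "(\<integral>x. g x \<partial>\<mu>) \<ge> 0" using assms(2) by (intro Bochner_Integration.integral_nonneg) (simp add: less_imp_le)
  ultimately show ?thesis by simp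
qed

lemma integrable_natural: "\<theta> \<in> N \<Longrightarrow> integrable \<mu> (\<lambda>x. exp (\<theta> \<bullet> b x))"
  by (simp add: natural_space_def)

lemma Z_pos: "\<theta> \<in> N \<Longrightarrow> Z \<theta> > 0"
  unfolding Z_def by (intro integral_pos_of_pos integrable_natural) auto

lemma exp_A: "\<theta> \<in> N \<Longrightarrow> exp (A \<theta>) = Z \<theta>"
  using Z_pos by (simp add: log_partition_def Z_def)

text \<open>
  If \<open>\<theta>\<close> is interior, then so are its translates by small multiples of the coordinate vectors, and
  the corresponding integrals dominate the exponential of a small multiple of \<open>norm (b x)\<close>. This
  supplies the dominating functions below.
\<close>

lemma exponential_moment:
  assumes "\<theta> \<in> interior N"
  obtains r where "r > 0" "integrable \<mu> (\<lambda>x. exp (\<theta> \<bullet> b x + r * norm (b x)))"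
proof -
  obtain e where e: "e > 0" "ball \<theta> e \<subseteq> N"
    using assms by (metis interior_subset mem_interior)
  define d where "d = real (DIM(real ^ 'p))"
  define r where "r = e / (2 * d)"
  have d: "d > 0" by (simp add: d_def)
  have r: "r > 0" "r * d = e / 2" using e d by (auto simp: r_def)
  have N: "\<theta> + (e / 2) *\<^sub>R i \<in> N" "\<theta> - (e / 2) *\<^sub>R i \<in> N" if "i \<in> Basis" for i
    using e that by (auto intro!: subsetD[OF e(2)] simp: dist_norm)
  have "integrable \<mu> (\<lambda>x. \<Sum>i\<in>Basis. exp ((\<theta> + (e / 2) *\<^sub>R i) \<bullet> b x) + exp ((\<theta> - (e / 2) *\<^sub>R i) \<bullet> b x))"
    by (intro Bochner_Integration.integrable_sum Bochner_Integration.integrable_add integrable_natural N)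
  then have "integrable \<mu> (\<lambda>x. exp (\<theta> \<bullet> b x + r * norm (b x)))"
  proof (rule Bochner_Integration.integrable_bound)
    have "exp (\<theta> \<bullet> b x + r * norm (b x))
        \<le> (\<Sum>i\<in>Basis. exp ((\<theta> + (e / 2) *\<^sub>R i) \<bullet> b x) + exp ((\<theta> - (e / 2) *\<^sub>R i) \<bullet> b x))" for x
    proof -
      have "exp (r * norm (b x)) \<le> (\<Sum>i\<in>Basis. exp (r * d * (i \<bullet> b x)) + exp (- (r * d * (i \<bullet> b x))))"
        unfolding d_def using r(1) by (intro exp_norm_le_sum_exp) simp
      from mult_left_mono[OF this, of "exp (\<theta> \<bullet> b x)"] show ?thesis
        unfolding r(2) by (simp add: sum_distrib_left exp_add inner_simps distrib_left flip: exp_add)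
    qed
    then show "AE x in \<mu>. norm (exp (\<theta> \<bullet> b x + r * norm (b x)))
        \<le> norm (\<Sum>i\<in>Basis. exp ((\<theta> + (e / 2) *\<^sub>R i) \<bullet> b x) + exp ((\<theta> - (e / 2) *\<^sub>R i) \<bullet> b x))"
      by (intro AE_I2) (simp add: order_trans[OF _ abs_ge_self])
  qed measurable
  with r(1) show ?thesis by (rule that)
qed

lemma integrable_of_exp_bound:
  fixes g :: "'x \<Rightarrow> 'c::{banach, second_countable_topology}"
  assumes "integrable \<mu> (\<lambda>x. exp (\<theta> \<bullet> b x + r * norm (b x)))" "g \<in> borel_measurable \<mu>"
    "\<And>x. norm (g x) \<le> K * exp (\<theta> \<bullet> b x + r * norm (b x))"
  shows "integrable \<mu> g"
proof (rule Bochner_Integration.integrable_bound[OF integrable_mult_right[OF assms(1), of K] assms(2)])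
  show "AE x in \<mu>. norm (g x) \<le> norm (K * exp (\<theta> \<bullet> b x + r * norm (b x)))"
    using assms(3) by (intro AE_I2) (metis order_trans real_norm_def abs_ge_self)
qed

lemma integrable_mean:
  assumes "\<theta> \<in> interior N" shows "integrable \<mu> (\<lambda>x. exp (\<theta> \<bullet> b x) *\<^sub>R b x)"
proof -
  obtain r where r: "r > 0" "integrable \<mu> (\<lambda>x. exp (\<theta> \<bullet> b x + r * norm (b x)))"
    using exponential_moment[OF assms] .
  show ?thesis
  proof (rule integrable_of_exp_bound[OF r(2), where K = "1 / r"])
    show "norm (exp (\<theta> \<bullet> b x) *\<^sub>R b x) \<le> 1 / r * exp (\<theta> \<bullet> b x + r * norm (b x))" for x
      using mult_left_mono[OF power_le_exp(1)[of "norm (b x)" r], of "exp (\<theta> \<bullet> b x)"] r(1)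
      by (simp add: exp_add)
  qed measurable
qed

lemma integral_exp_inner:
  assumes "\<theta> \<in> interior N"
  shows "integrable \<mu> (\<lambda>x. exp (\<theta> \<bullet> b x) * (v \<bullet> b x))"
    and "(\<integral>x. exp (\<theta> \<bullet> b x) * (v \<bullet> b x) \<partial>\<mu>) = Z \<theta> * (v \<bullet> mean \<theta>)"
proof -
  have i: "integrable \<mu> (\<lambda>x. exp (\<theta> \<bullet> b x) *\<^sub>R b x)" using integrable_mean[OF assms] .
  show "integrable \<mu> (\<lambda>x. exp (\<theta> \<bullet> b x) * (v \<bullet> b x))"
    using integrable_inner_right[OF i, of v] by simp
  have "Z \<theta> > 0" using Z_pos assms interior_subset by blast
  then show "(\<integral>x. exp (\<theta> \<bullet> b x) * (v \<bullet> b x) \<partial>\<mu>) = Z \<theta> * (v \<bullet> mean \<theta>)"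
    using integral_inner_right[OF i, of v] by (simp add: mean_def)
qed

text \<open>
  Differentiation under the integral sign: the second-order remainder of the exponential is bounded
  by \<open>(norm h)\<^sup>2\<close> times an integrable function, by means of the exponential moment.
\<close>

lemma GDERIV_Z:
  assumes "\<theta> \<in> interior N"
  shows "GDERIV Z \<theta> :> Z \<theta> *\<^sub>R mean \<theta>"
proof -
  obtain r where r: "r > 0" "integrable \<mu> (\<lambda>x. exp (\<theta> \<bullet> b x + r * norm (b x)))"
    using exponential_moment[OF assms] .
  have \<theta>N: "\<theta> \<in> N" using assms interior_subset by blast
  \<comment> \<open>Half of \<open>r\<close> bounds the growth of the exponential in the remainder and the other half absorbs the
     factor \<open>(norm (b x))\<^sup>2\<close>, at the cost of \<open>4 / (r / 2)\<^sup>2\<close>.\<close>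
  define K where "K = (16 / r\<^sup>2) * (\<integral>x. exp (\<theta> \<bullet> b x + r * norm (b x)) \<partial>\<mu>)"
  show ?thesis
  proof (rule GDERIV_of_quadratic_error[of "r / 2" _ _ _ K])
    fix h :: "real ^ 'p" assume h: "norm h < r / 2"
    let ?R = "\<lambda>x. exp (\<theta> \<bullet> b x) * (exp (h \<bullet> b x) - 1 - h \<bullet> b x)"
    have R0: "0 \<le> ?R x" for x
      using exp_ge_add_one_self[of "h \<bullet> b x"] by (intro mult_nonneg_nonneg) (simp, linarith)
    have bound: "?R x \<le> (norm h)\<^sup>2 * (16 / r\<^sup>2) * exp (\<theta> \<bullet> b x + r * norm (b x))" for x
    proof -
      let ?n = "norm (b x)"
      have hb: "\<bar>h \<bullet> b x\<bar> \<le> norm h * ?n" by (rule Cauchy_Schwarz_ineq2)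
      also have "\<dots> \<le> r / 2 * ?n" using h by (intro mult_right_mono) auto
      finally have hb2: "\<bar>h \<bullet> b x\<bar> \<le> r / 2 * ?n" .
      have "exp (h \<bullet> b x) - 1 - h \<bullet> b x \<le> (h \<bullet> b x)\<^sup>2 * exp \<bar>h \<bullet> b x\<bar>"
        by (rule exp_minus_linear_bounds)
      also have "\<dots> \<le> (norm h * ?n)\<^sup>2 * exp (r / 2 * ?n)"
        using hb hb2 by (intro mult_mono abs_le_square_iff[THEN iffD1]) auto
      also have "\<dots> \<le> (norm h)\<^sup>2 * (16 / r\<^sup>2 * exp (r / 2 * ?n)) * exp (r / 2 * ?n)"
        unfolding power_mult_distrib using power_le_exp(2)[of ?n "r / 2"] r(1)
        by (intro mult_right_mono mult_left_mono) (simp_all add: power_divide)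
      also have "\<dots> = (norm h)\<^sup>2 * (16 / r\<^sup>2) * exp (r * ?n)" by (simp flip: exp_add)
      finally have "?R x \<le> exp (\<theta> \<bullet> b x) * ((norm h)\<^sup>2 * (16 / r\<^sup>2) * exp (r * ?n))"
        by (intro mult_left_mono) auto
      then show ?thesis by (simp add: exp_add mult_ac)
    qed
    have intR: "integrable \<mu> ?R"
      by (rule integrable_of_exp_bound[OF r(2), where K = "(norm h)\<^sup>2 * (16 / r\<^sup>2)"])
        (use bound R0 in auto)
    have "integrable \<mu> (\<lambda>x. exp (\<theta> \<bullet> b x) + exp (\<theta> \<bullet> b x) * (h \<bullet> b x) + ?R x)"
      using intR integral_exp_inner(1)[OF assms, of h] integrable_natural[OF \<theta>N] by auto
    have split: "exp ((\<theta> + h) \<bullet> b x) = exp (\<theta> \<bullet> b x) + exp (\<theta> \<bullet> b x) * (h \<bullet> b x) + ?R x" for x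
      by (simp add: inner_add_left exp_add algebra_simps)
    have "Z (\<theta> + h) = Z \<theta> + Z \<theta> * (h \<bullet> mean \<theta>) + (\<integral>x. ?R x \<partial>\<mu>)"
      unfolding Z_def[of "\<theta> + h"] split
      using intR integral_exp_inner[OF assms, of h] integrable_natural[OF \<theta>N]
      by (simp add: Z_def)
    moreover have "(\<integral>x. ?R x \<partial>\<mu>) \<ge> 0" using R0 by (intro Bochner_Integration.integral_nonneg)
    moreover have "(\<integral>x. ?R x \<partial>\<mu>) \<le> (\<integral>x. (norm h)\<^sup>2 * (16 / r\<^sup>2) * exp (\<theta> \<bullet> b x + r * norm (b x)) \<partial>\<mu>)"
      using intR bound r(2) by (intro integral_mono) auto
    ultimately show "\<bar>Z (\<theta> + h) - Z \<theta> - h \<bullet> Z \<theta> *\<^sub>R mean \<theta>\<bar> \<le> K * (norm h)\<^sup>2"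
      by (simp add: K_def algebra_simps)
  qed (use r in auto)
qed

lemma GDERIV_log_partition:
  assumes "\<theta> \<in> interior N"
  shows "GDERIV A \<theta> :> mean \<theta>"
proof -
  have z: "Z \<theta> > 0" using Z_pos assms interior_subset by blast
  have "GDERIV (\<lambda>t. ln (Z t)) \<theta> :> (1 / Z \<theta>) *\<^sub>R (Z \<theta> *\<^sub>R mean \<theta>)"
    using GDERIV_DERIV_compose[OF GDERIV_Z[OF assms]] z DERIV_ln_divide by blast
  moreover have "A = (\<lambda>t. ln (Z t))" by (simp add: log_partition_def Z_def fun_eq_iff)
  ultimately show ?thesis using z by simp
qed

text \<open>
  The exponent in the second formula is the excess of \<open>A\<close> over its tangent, that is, the Bregman divergence of
  \<open>A\<close>. Its exponential is the mean of \<open>exp Y\<close> under the density with parameter \<open>\<theta>\<close>, where \<open>Y\<close> is centred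
  under that density. Subtracting \<open>1 + Y\<close> inside the integral therefore leaves a nonnegative
  integrand, which makes both convexity and strong convexity of \<open>A\<close> visible.
\<close>

lemma exp_bregman_log_partition:
  assumes \<theta>: "\<theta> \<in> interior N" and \<theta>': "\<theta>' \<in> N"
  defines "Y \<equiv> \<lambda>x. (\<theta>' - \<theta>) \<bullet> (b x - mean \<theta>)"
  shows "integrable \<mu> (\<lambda>x. exp (\<theta> \<bullet> b x) * (exp (Y x) - 1 - Y x))"
    and "exp (A \<theta>' - A \<theta> - mean \<theta> \<bullet> (\<theta>' - \<theta>))
      = 1 + (\<integral>x. exp (\<theta> \<bullet> b x) * (exp (Y x) - 1 - Y x) \<partial>\<mu>) / Z \<theta>"
proof -
  let ?v = "\<theta>' - \<theta>"
  have \<theta>N: "\<theta> \<in> N" using \<theta> interior_subset by blast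
  have e: "exp (\<theta> \<bullet> b x) * (exp (Y x) - 1 - Y x) = exp (- (?v \<bullet> mean \<theta>)) * exp (\<theta>' \<bullet> b x)
       + (?v \<bullet> mean \<theta> - 1) * exp (\<theta> \<bullet> b x) - exp (\<theta> \<bullet> b x) * (?v \<bullet> b x)" for x
    by (simp add: Y_def inner_diff_left inner_diff_right algebra_simps flip: exp_add)
  note I = integral_exp_inner[OF \<theta>, of ?v] integrable_natural[OF \<theta>N] integrable_natural[OF \<theta>']
  show "integrable \<mu> (\<lambda>x. exp (\<theta> \<bullet> b x) * (exp (Y x) - 1 - Y x))"
    unfolding e using I by auto
  have "(\<integral>x. exp (\<theta> \<bullet> b x) * (exp (Y x) - 1 - Y x) \<partial>\<mu>)
      = exp (- (?v \<bullet> mean \<theta>)) * Z \<theta>' + (?v \<bullet> mean \<theta> - 1) * Z \<theta> - Z \<theta> * (?v \<bullet> mean \<theta>)"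
    unfolding e using I by (simp add: Z_def)
  also have "\<dots> = exp (- (?v \<bullet> mean \<theta>)) * Z \<theta>' - Z \<theta>" by (simp add: algebra_simps)
  finally have "1 + (\<integral>x. exp (\<theta> \<bullet> b x) * (exp (Y x) - 1 - Y x) \<partial>\<mu>) / Z \<theta>
      = exp (- (?v \<bullet> mean \<theta>)) * Z \<theta>' / Z \<theta>"
    using Z_pos[OF \<theta>N] by (simp add: field_simps)
  also have "\<dots> = exp (A \<theta>' - A \<theta> - mean \<theta> \<bullet> ?v)"
    by (simp add: exp_diff exp_minus exp_A[OF \<theta>N] exp_A[OF \<theta>'] inner_commute[of "mean \<theta>"] divide_inverse ac_simps)
  finally show "exp (A \<theta>' - A \<theta> - mean \<theta> \<bullet> (\<theta>' - \<theta>))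
      = 1 + (\<integral>x. exp (\<theta> \<bullet> b x) * (exp (Y x) - 1 - Y x) \<partial>\<mu>) / Z \<theta>" by simp
qed

lemma log_partition_above_tangent:
  assumes \<theta>: "\<theta> \<in> interior N" and \<theta>': "\<theta>' \<in> N"
  shows "A \<theta>' \<ge> A \<theta> + mean \<theta> \<bullet> (\<theta>' - \<theta>)"
proof -
  let ?Y = "\<lambda>x. (\<theta>' - \<theta>) \<bullet> (b x - mean \<theta>)"
  have "0 \<le> exp (\<theta> \<bullet> b x) * (exp (?Y x) - 1 - ?Y x)" for x
    using exp_ge_add_one_self[of "?Y x"] by (intro mult_nonneg_nonneg) (auto simp: algebra_simps)
  then have "(\<integral>x. exp (\<theta> \<bullet> b x) * (exp (?Y x) - 1 - ?Y x) \<partial>\<mu>) \<ge> 0" by (rule Bochner_Integration.integral_nonneg)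
  then have "exp (A \<theta>' - A \<theta> - mean \<theta> \<bullet> (\<theta>' - \<theta>)) \<ge> exp 0"
    unfolding exp_bregman_log_partition(2)[OF assms]
    using Z_pos[of \<theta>] \<theta> interior_subset by (auto intro: divide_nonneg_pos)
  then show ?thesis unfolding exp_le_cancel_iff by linarith
qed

text \<open>
  By \<open>exp Y - 1 - Y \<ge> Y\<^sup>2 / 2 * exp (-\<bar>Y\<bar>)\<close>, the integral in the preceding formula is bounded below by a
  weighted second moment of \<open>Y x = v \<bullet> b x - v \<bullet> mean \<theta>\<close>. Replacing the weight by a smaller one that
  is independent of \<open>\<theta>\<close> and \<open>\<theta>'\<close> turns this into a fixed quadratic form in the pair
  \<open>(v, v \<bullet> mean \<theta>)\<close>, evaluated on the vectors \<open>(b x, -1)\<close>. Full rank makes this form positive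
  definite.
\<close>

lemma log_partition_strongly_convex_near:
  assumes "\<theta>0 \<in> interior N"
  obtains d \<kappa> where "d > 0" "\<kappa> > 0" "cball \<theta>0 d \<subseteq> interior N"
    "\<And>\<theta> \<theta>'. \<theta> \<in> cball \<theta>0 d \<Longrightarrow> \<theta>' \<in> cball \<theta>0 d \<Longrightarrow>
       A \<theta>' \<ge> A \<theta> + mean \<theta> \<bullet> (\<theta>' - \<theta>) + \<kappa> * (norm (\<theta>' - \<theta>))\<^sup>2"
proof -
  obtain r where r: "r > 0" and intr: "integrable \<mu> (\<lambda>x. exp (\<theta>0 \<bullet> b x + r * norm (b x)))"
    using exponential_moment[OF assms] .
  obtain e where e: "e > 0" "cball \<theta>0 e \<subseteq> interior N"
    using assms open_contains_cball[of "interior N"] by auto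
  define d where "d = min e (r / 2)"
  have d: "d > 0" "d \<le> r / 2" "cball \<theta>0 d \<subseteq> interior N"
    using e r by (auto simp: d_def intro: subset_trans[OF subset_cball])
  have inner_le: "\<bar>(\<theta> - \<theta>0) \<bullet> b x\<bar> \<le> d * norm (b x)" if "\<theta> \<in> cball \<theta>0 d" for \<theta> x
  proof -
    have "\<bar>(\<theta> - \<theta>0) \<bullet> b x\<bar> \<le> norm (\<theta> - \<theta>0) * norm (b x)" by (rule Cauchy_Schwarz_ineq2)
    also have "\<dots> \<le> d * norm (b x)"
      using that by (intro mult_right_mono) (auto simp: dist_norm norm_minus_commute)
    finally show ?thesis .
  qed
  have lower: "\<theta>0 \<bullet> b x - d * norm (b x) \<le> \<theta> \<bullet> b x"
    and upper: "\<theta> \<bullet> b x \<le> \<theta>0 \<bullet> b x + d * norm (b x)" if "\<theta> \<in> cball \<theta>0 d" for \<theta> x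
    using inner_le[OF that, of x] by (auto simp: inner_diff_left)
  have dr: "d * norm (b x) \<le> r / 2 * norm (b x)" for x using d by (intro mult_right_mono) auto
  have inN: "\<theta> \<in> interior N" "\<theta> \<in> N" if "\<theta> \<in> cball \<theta>0 d" for \<theta>
    using that d(3) interior_subset by blast+

  define I where "I = (\<integral>x. exp (\<theta>0 \<bullet> b x + r * norm (b x)) \<partial>\<mu>)"
  define c where "c = (\<integral>x. exp (\<theta>0 \<bullet> b x - d * norm (b x)) \<partial>\<mu>)"
  have ic: "integrable \<mu> (\<lambda>x. exp (\<theta>0 \<bullet> b x - d * norm (b x)))"
  proof (rule integrable_of_exp_bound[OF intr, where K = 1])
    fix x
    have "0 \<le> d * norm (b x)" "0 \<le> r * norm (b x)" using d(1) r by auto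
    then show "norm (exp (\<theta>0 \<bullet> b x - d * norm (b x))) \<le> 1 * exp (\<theta>0 \<bullet> b x + r * norm (b x))" by simp
  qed measurable
  have c: "c > 0" unfolding c_def using ic by (intro integral_pos_of_pos) auto
  have I: "I > 0" unfolding I_def using intr by (intro integral_pos_of_pos) auto
  have Z_lower: "c \<le> Z \<theta>" and Z_upper: "Z \<theta> \<le> I" if "\<theta> \<in> cball \<theta>0 d" for \<theta>
  proof -
    note i = integrable_natural[OF inN(2)[OF that]]
    show "c \<le> Z \<theta>" unfolding c_def Z_def using ic i lower[OF that] by (intro integral_mono) auto
    have "\<theta> \<bullet> b x \<le> \<theta>0 \<bullet> b x + r * norm (b x)" for x
    proof -
      have "0 \<le> r * norm (b x)" using r by simp
      then show ?thesis using upper[OF that, of x] dr[of x] by linarith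
    qed
    then show "Z \<theta> \<le> I" unfolding I_def Z_def using intr i by (intro integral_mono) auto
  qed
  define B where "B = 2 / r * I / c"
  have B: "B \<ge> 0" using r I c by (simp add: B_def)
  have mean_bound: "norm (mean \<theta>) \<le> B" if \<theta>: "\<theta> \<in> cball \<theta>0 d" for \<theta>
  proof -
    have "norm (\<integral>x. exp (\<theta> \<bullet> b x) *\<^sub>R b x \<partial>\<mu>) \<le> (\<integral>x. norm (exp (\<theta> \<bullet> b x) *\<^sub>R b x) \<partial>\<mu>)"
      by (rule integral_norm_bound)
    also have "\<dots> \<le> (\<integral>x. 2 / r * exp (\<theta>0 \<bullet> b x + r * norm (b x)) \<partial>\<mu>)"
    proof (intro integral_mono integrable_norm integrable_mean inN \<theta> integrable_mult_right intr)
      fix x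
      have "exp (\<theta> \<bullet> b x) * norm (b x)
          \<le> exp (\<theta>0 \<bullet> b x + r / 2 * norm (b x)) * (exp (r / 2 * norm (b x)) / (r / 2))"
        using upper[OF \<theta>, of x] dr[of x] power_le_exp(1)[of "norm (b x)" "r / 2"] r
        by (intro mult_mono) auto
      also have "\<dots> = 2 / r * exp (\<theta>0 \<bullet> b x + r * norm (b x))"
        by (simp flip: exp_add)
      finally show "norm (exp (\<theta> \<bullet> b x) *\<^sub>R b x) \<le> 2 / r * exp (\<theta>0 \<bullet> b x + r * norm (b x))"
        by simp
    qed
    also have "\<dots> = 2 / r * I" by (simp add: I_def)
    finally have "norm (\<integral>x. exp (\<theta> \<bullet> b x) *\<^sub>R b x \<partial>\<mu>) / Z \<theta> \<le> 2 / r * I / c"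
      using Z_lower[OF \<theta>] c r I by (intro frac_le) auto
    then show ?thesis using Z_lower[OF \<theta>] c by (simp add: mean_def B_def)
  qed

  \<comment> \<open>The factor \<open>3\<close> is made up of one \<open>d\<close> for passing from \<open>\<theta>\<close> to \<open>\<theta>0\<close> in the density, and of \<open>2 * d\<close>, the
     largest distance of two points of the ball, for the weight \<open>exp (-\<bar>Y x\<bar>)\<close>.\<close>
  define \<omega> where "\<omega> x = exp (\<theta>0 \<bullet> b x - 3 * d * norm (b x))" for x
  have w_int: "integrable \<mu> (\<lambda>x. \<omega> x * (norm (b x, - 1 :: real))\<^sup>2)"
  proof (rule integrable_of_exp_bound[OF intr, where K = "4 / r\<^sup>2 + 1"])
    fix x
    have nn: "0 \<le> d * norm (b x)" "0 \<le> r * norm (b x)" using d(1) r by auto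
    have "(norm (b x, - 1 :: real))\<^sup>2 = (norm (b x))\<^sup>2 + 1" by (simp add: norm_Pair)
    also have "\<dots> \<le> (4 / r\<^sup>2 + 1) * exp (r * norm (b x))"
      using power_le_exp(2)[of "norm (b x)" r] r nn(2) unfolding distrib_right
      by (intro add_mono) auto
    finally have "\<omega> x * (norm (b x, - 1 :: real))\<^sup>2
        \<le> exp (\<theta>0 \<bullet> b x) * ((4 / r\<^sup>2 + 1) * exp (r * norm (b x)))"
      using nn(1) by (intro mult_mono) (auto simp: \<omega>_def)
    then show "norm (\<omega> x * (norm (b x, - 1 :: real))\<^sup>2) \<le> (4 / r\<^sup>2 + 1) * exp (\<theta>0 \<bullet> b x + r * norm (b x))"
      by (simp add: \<omega>_def exp_add abs_mult mult_ac)
  qed (unfold \<omega>_def, measurable)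
  obtain l where l: "l > 0"
    "\<And>z. (\<integral>x. \<omega> x * (z \<bullet> (b x, - 1 :: real))\<^sup>2 \<partial>\<mu>) \<ge> l * (norm z)\<^sup>2"
  proof (rule nondegenerate_quadratic_form_lower_bound[OF _ _ _ w_int])
    show "\<omega> \<in> borel_measurable \<mu>" unfolding \<omega>_def by measurable
    fix z :: "(real ^ 'p) \<times> real" assume "AE x in \<mu>. z \<bullet> (b x, - 1) = 0"
    then have "AE x in \<mu>. fst z \<bullet> b x - snd z = 0" by (simp add: inner_prod_def)
    from affine_relation_trivial[OF this] show "z = 0" by (simp add: prod_eq_iff)
  qed (auto simp: \<omega>_def)

  define k where "k = exp (- (2 * d * B)) / 2"
  have k: "k > 0" by (simp add: k_def)
  define \<kappa>1 where "\<kappa>1 = k * l / I"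
  have \<kappa>1: "\<kappa>1 > 0" using k l I by (simp add: \<kappa>1_def)
  define \<kappa> where "\<kappa> = \<kappa>1 / (1 + \<kappa>1 * (2 * d)\<^sup>2)"
  have "0 \<le> \<kappa>1 * (2 * d)\<^sup>2" using \<kappa>1 by (intro mult_nonneg_nonneg) auto
  then have pos: "1 + \<kappa>1 * (2 * d)\<^sup>2 > 0" by linarith
  have \<kappa>: "\<kappa> > 0" using \<kappa>1 pos by (simp add: \<kappa>_def)
  have "A \<theta>' \<ge> A \<theta> + mean \<theta> \<bullet> (\<theta>' - \<theta>) + \<kappa> * (norm (\<theta>' - \<theta>))\<^sup>2"
    if \<theta>: "\<theta> \<in> cball \<theta>0 d" and \<theta>': "\<theta>' \<in> cball \<theta>0 d" for \<theta> \<theta>'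
  proof -
    define v where "v = \<theta>' - \<theta>"
    define Y where "Y x = v \<bullet> (b x - mean \<theta>)" for x
    let ?u = "(v, v \<bullet> mean \<theta>)"
    have Yeq: "Y x = ?u \<bullet> (b x, - 1 :: real)" for x by (simp add: Y_def inner_diff_right)
    have nv: "norm v \<le> 2 * d"
      using \<theta> \<theta>' dist_triangle2[of \<theta>' \<theta> \<theta>0] by (simp add: v_def dist_norm norm_minus_commute)
    have Yabs: "\<bar>Y x\<bar> \<le> 2 * d * norm (b x) + 2 * d * B" for x
    proof -
      have "\<bar>Y x\<bar> \<le> norm v * norm (b x - mean \<theta>)" unfolding Y_def by (rule Cauchy_Schwarz_ineq2)
      also have "\<dots> \<le> (2 * d) * (norm (b x) + B)"
        using nv mean_bound[OF \<theta>] norm_triangle_ineq4[of "b x" "mean \<theta>"] d(1)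
        by (intro mult_mono) auto
      finally show ?thesis by (simp add: distrib_left)
    qed
    have pointwise: "k * (\<omega> x * (Y x)\<^sup>2) \<le> exp (\<theta> \<bullet> b x) * (exp (Y x) - 1 - Y x)" for x
    proof -
      have "k * (\<omega> x * (Y x)\<^sup>2)
          = exp (\<theta>0 \<bullet> b x - d * norm (b x)) * ((Y x)\<^sup>2 / 2 * exp (- (2 * d * norm (b x) + 2 * d * B)))"
        by (simp add: k_def \<omega>_def algebra_simps flip: exp_add)
      also have "\<dots> \<le> exp (\<theta> \<bullet> b x) * ((Y x)\<^sup>2 / 2 * exp (- \<bar>Y x\<bar>))"
        using lower[OF \<theta>, of x] Yabs[of x] by (intro mult_mono) auto
      also have "\<dots> \<le> exp (\<theta> \<bullet> b x) * (exp (Y x) - 1 - Y x)"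
        using exp_minus_linear_bounds(2) by (intro mult_left_mono) auto
      finally show ?thesis .
    qed
    note breg = exp_bregman_log_partition[OF inN(1)[OF \<theta>] inN(2)[OF \<theta>'], folded v_def, folded Y_def]
    have w2: "integrable \<mu> (\<lambda>x. \<omega> x * (Y x)\<^sup>2)"
    proof (rule Bochner_Integration.integrable_bound[OF integrable_mult_right[OF breg(1), of "1 / k"]])
      show "AE x in \<mu>. norm (\<omega> x * (Y x)\<^sup>2)
          \<le> norm (1 / k * (exp (\<theta> \<bullet> b x) * (exp (Y x) - 1 - Y x)))"
      proof (intro AE_I2)
        fix x
        have "norm (\<omega> x * (Y x)\<^sup>2) = \<omega> x * (Y x)\<^sup>2" by (simp add: \<omega>_def)
        also have "\<dots> \<le> 1 / k * (exp (\<theta> \<bullet> b x) * (exp (Y x) - 1 - Y x))"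
          using pointwise[of x] k by (simp add: field_simps)
        finally show "norm (\<omega> x * (Y x)\<^sup>2)
          \<le> norm (1 / k * (exp (\<theta> \<bullet> b x) * (exp (Y x) - 1 - Y x)))"
          unfolding real_norm_def by linarith
      qed
    qed (unfold \<omega>_def Y_def, measurable)
    have "(norm v)\<^sup>2 \<le> (norm ?u)\<^sup>2" by (simp add: norm_Pair)
    then have "k * (l * (norm v)\<^sup>2) \<le> k * (l * (norm ?u)\<^sup>2)"
      using k l(1) by (intro mult_left_mono) auto
    also have "\<dots> \<le> k * (\<integral>x. \<omega> x * (Y x)\<^sup>2 \<partial>\<mu>)"
      using l(2)[of ?u] k by (intro mult_left_mono) (auto simp: Yeq)
    also have "\<dots> \<le> (\<integral>x. exp (\<theta> \<bullet> b x) * (exp (Y x) - 1 - Y x) \<partial>\<mu>)"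
      unfolding integral_mult_right_zero[symmetric]
      using w2 breg(1) pointwise by (intro integral_mono) auto
    finally have le: "k * (l * (norm v)\<^sup>2) \<le> (\<integral>x. exp (\<theta> \<bullet> b x) * (exp (Y x) - 1 - Y x) \<partial>\<mu>)" .
    moreover have "0 \<le> k * (l * (norm v)\<^sup>2)" using k l(1) by simp
    ultimately have "k * (l * (norm v)\<^sup>2) / I
        \<le> (\<integral>x. exp (\<theta> \<bullet> b x) * (exp (Y x) - 1 - Y x) \<partial>\<mu>) / Z \<theta>"
      using Z_upper[OF \<theta>] Z_pos[OF inN(2)[OF \<theta>]] by (intro frac_le) auto
    then have ge: "1 + \<kappa>1 * (norm v)\<^sup>2 \<le> exp (A \<theta>' - A \<theta> - mean \<theta> \<bullet> v)"
      unfolding breg(2) by (simp add: \<kappa>1_def mult_ac)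
    \<comment> \<open>Taking logarithms costs a constant factor, since \<open>norm v\<close> is bounded on the ball and
       \<open>ln (1 + y) \<ge> y / (1 + y)\<close>.\<close>
    let ?y = "\<kappa>1 * (norm v)\<^sup>2"
    have y: "0 \<le> ?y" "?y \<le> \<kappa>1 * (2 * d)\<^sup>2" using \<kappa>1 power_mono[OF nv norm_ge_zero, of 2] by (auto intro: mult_left_mono)
    have "\<kappa> * (norm v)\<^sup>2 = ?y / (1 + \<kappa>1 * (2 * d)\<^sup>2)" by (simp add: \<kappa>_def)
    also have "\<dots> \<le> ?y / (1 + ?y)" using y by (intro divide_left_mono mult_pos_pos) auto
    also have "\<dots> = 1 - 1 / (1 + ?y)" using y by (simp add: field_simps)
    also have "\<dots> \<le> - ln (1 / (1 + ?y))" using ln_le_minus_one[of "1 / (1 + ?y)"] y by simp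
    also have "\<dots> = ln (1 + ?y)" using y by (simp add: ln_div)
    also have "\<dots> \<le> A \<theta>' - A \<theta> - mean \<theta> \<bullet> v"
      using ln_mono[OF ge] y by simp
    finally show ?thesis by (simp add: v_def)
  qed
  with d(1) \<kappa> d(3) show ?thesis by (rule that)
qed

end

section \<open>Exponentially tilted means of a sample\<close>

definition laplace_sum :: "(nat \<Rightarrow> 'a::euclidean_space) \<Rightarrow> nat \<Rightarrow> 'a \<Rightarrow> real" where
  "laplace_sum a n \<eta> = (\<Sum>i<n. exp (\<eta> \<bullet> a i))"

text \<open>
  This is the gradient of \<open>ln \<circ> laplace_sum a n\<close>. Its value at \<open>0\<close> is the arithmetic mean of the
  points, and \<open>0\<close> when there are no points.
\<close>

definition tilted_mean :: "(nat \<Rightarrow> 'a::euclidean_space) \<Rightarrow> nat \<Rightarrow> 'a \<Rightarrow> 'a" where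
  "tilted_mean a n \<eta> = (1 / laplace_sum a n \<eta>) *\<^sub>R (\<Sum>i<n. exp (\<eta> \<bullet> a i) *\<^sub>R a i)"

lemma laplace_sum_pos: "n > 0 \<Longrightarrow> laplace_sum a n \<eta> > 0"
  unfolding laplace_sum_def by (intro sum_pos) auto

text \<open>
  Numerator and denominator of the tilted mean are Lipschitz, with constants controlled by sums of
  \<open>norm (a i) * exp (r / 2 * norm (a i))\<close> and \<open>(norm (a i))\<^sup>2 * exp (r / 2 * norm (a i))\<close>. These are dominated
  by the sum of \<open>exp (r * norm (a i))\<close>, and the same sum keeps the denominator away from \<open>0\<close>.
\<close>

lemma tilted_mean_Lipschitz:
  fixes a :: "nat \<Rightarrow> 'a::euclidean_space"
  assumes n: "n > 0" and r: "r > 0" and W: "(\<Sum>i<n. exp (r * norm (a i))) \<le> real n * W"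
    and \<eta>: "norm \<eta> \<le> r / 2" "norm \<eta>' \<le> r / 2"
  shows "norm (tilted_mean a n \<eta> - tilted_mean a n \<eta>') \<le> (16 * W^2 / r^2 + 4 * W^4 / r^2) * norm (\<eta> - \<eta>')"
proof -
  let ?S0 = "laplace_sum a n" let ?S1 = "\<lambda>\<eta>. \<Sum>i<n. exp (\<eta> \<bullet> a i) *\<^sub>R a i"
  let ?e = "\<lambda>i. exp (r * norm (a i))" and ?h = "\<lambda>i. exp (r / 2 * norm (a i))"
  let ?\<Delta> = "norm (\<eta> - \<eta>')"
  have "(\<Sum>i<n. (1::real)) \<le> (\<Sum>i<n. ?e i)" using r by (intro sum_mono) auto
  with W have "real n * 1 \<le> real n * W" by simp
  then have "1 \<le> W" using n by (simp add: mult_le_cancel_left)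
  then have W0: "W > 0" by simp
  have inner: "\<bar>\<zeta> \<bullet> a i\<bar> \<le> r / 2 * norm (a i)" if "norm \<zeta> \<le> r / 2" for \<zeta> i
    using Cauchy_Schwarz_ineq2[of \<zeta> "a i"] mult_right_mono[OF that norm_ge_zero[of "a i"]] by linarith
  have b1: "norm (a i) * ?h i \<le> 2 / r * ?e i" and b2: "(norm (a i))\<^sup>2 * ?h i \<le> 16 / r\<^sup>2 * ?e i" for i
  proof -
    have sq: "?h i * ?h i = ?e i" by (simp flip: exp_add)
    have "norm (a i) * ?h i \<le> (?h i / (r / 2)) * ?h i"
      using power_le_exp(1)[of "norm (a i)" "r / 2"] r by (intro mult_right_mono) auto
    then show "norm (a i) * ?h i \<le> 2 / r * ?e i" unfolding sq[symmetric] by (simp add: mult_ac)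
    have "(norm (a i))\<^sup>2 * ?h i \<le> (4 / (r / 2)\<^sup>2 * ?h i) * ?h i"
      using power_le_exp(2)[of "norm (a i)" "r / 2"] r by (intro mult_right_mono) auto
    then show "(norm (a i))\<^sup>2 * ?h i \<le> 16 / r\<^sup>2 * ?e i" unfolding sq[symmetric] by (simp add: mult.assoc power_divide)
  qed
  have S0_lower: "n / W \<le> ?S0 \<zeta>" if \<zeta>: "norm \<zeta> \<le> r / 2" for \<zeta>
  proof -
    have "2 / W - ?e i / W\<^sup>2 \<le> exp (\<zeta> \<bullet> a i)" for i
    proof -
      \<comment> \<open>The convex function \<open>1 / y\<close> lies above its tangent at \<open>y = W\<close>. Summed over \<open>i\<close>, this is the
         comparison of the harmonic with the arithmetic mean.\<close>
      have "0 \<le> (?e i / W - 1)\<^sup>2" by simp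
      then have "2 / W - ?e i / W\<^sup>2 \<le> 1 / ?e i"
        using W0 by (simp add: power2_eq_square field_simps)
      also have "\<dots> = exp (- (r * norm (a i)))" by (simp add: exp_minus field_simps)
      also have "\<dots> \<le> exp (\<zeta> \<bullet> a i)"
      proof -
        have "0 \<le> r * norm (a i)" using r by simp
        then show ?thesis using inner[OF \<zeta>, of i] by simp
      qed
      finally show ?thesis .
    qed
    then have "(\<Sum>i<n. 2 / W - ?e i / W\<^sup>2) \<le> ?S0 \<zeta>"
      unfolding laplace_sum_def by (intro sum_mono)
    moreover have "(\<Sum>i<n. 2 / W - ?e i / W\<^sup>2) = 2 * (n / W) - (\<Sum>i<n. ?e i) / W\<^sup>2"
      by (simp add: sum_subtractf sum_divide_distrib)
    moreover have "(\<Sum>i<n. ?e i) / W\<^sup>2 \<le> n / W"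
      using divide_right_mono[OF W, of "W\<^sup>2"] W0 by (simp add: power2_eq_square)
    ultimately show ?thesis by linarith
  qed
  have coeff: "\<bar>exp (\<eta> \<bullet> a i) - exp (\<eta>' \<bullet> a i)\<bar> \<le> ?\<Delta> * (norm (a i) * ?h i)" for i
  proof -
    have "\<bar>exp (\<eta> \<bullet> a i) - exp (\<eta>' \<bullet> a i)\<bar> \<le> \<bar>\<eta> \<bullet> a i - \<eta>' \<bullet> a i\<bar> * ?h i"
      using inner[OF \<eta>(1), of i] inner[OF \<eta>(2), of i] by (intro exp_diff_le) auto
    also have "\<dots> \<le> (?\<Delta> * norm (a i)) * ?h i"
      using Cauchy_Schwarz_ineq2[of "\<eta> - \<eta>'" "a i"] by (intro mult_right_mono) (auto simp: inner_diff_left)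
    finally show ?thesis by simp
  qed
  have D0: "\<bar>?S0 \<eta>' - ?S0 \<eta>\<bar> \<le> ?\<Delta> * (2 / r * (n * W))"
  proof -
    have "\<bar>?S0 \<eta>' - ?S0 \<eta>\<bar> \<le> (\<Sum>i<n. \<bar>exp (\<eta> \<bullet> a i) - exp (\<eta>' \<bullet> a i)\<bar>)"
      unfolding laplace_sum_def sum_subtractf[symmetric] by (subst abs_minus_commute) (rule order_trans[OF sum_abs], simp add: abs_minus_commute)
    also have "\<dots> \<le> (\<Sum>i<n. ?\<Delta> * (2 / r * ?e i))"
      using coeff b1 by (intro sum_mono) (meson mult_left_mono norm_ge_zero order_trans)
    also have "\<dots> \<le> ?\<Delta> * (2 / r * (n * W))"
      using W r unfolding sum_distrib_left[symmetric] by (intro mult_left_mono) auto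
    finally show ?thesis .
  qed
  have D1: "norm (?S1 \<eta> - ?S1 \<eta>') \<le> ?\<Delta> * (16 / r\<^sup>2 * (n * W))"
  proof -
    have "norm (?S1 \<eta> - ?S1 \<eta>') \<le> (\<Sum>i<n. \<bar>exp (\<eta> \<bullet> a i) - exp (\<eta>' \<bullet> a i)\<bar> * norm (a i))"
      unfolding sum_subtractf[symmetric] scaleR_diff_left[symmetric] by (rule sum_norm_le) simp
    also have "\<dots> \<le> (\<Sum>i<n. ?\<Delta> * (16 / r\<^sup>2 * ?e i))"
    proof (rule sum_mono)
      fix i
      have "\<bar>exp (\<eta> \<bullet> a i) - exp (\<eta>' \<bullet> a i)\<bar> * norm (a i) \<le> ?\<Delta> * (norm (a i) * ?h i) * norm (a i)"
        using coeff by (intro mult_right_mono) auto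
      also have "\<dots> = ?\<Delta> * ((norm (a i))\<^sup>2 * ?h i)" by (simp add: power2_eq_square mult_ac)
      also have "\<dots> \<le> ?\<Delta> * (16 / r\<^sup>2 * ?e i)" using b2 by (intro mult_left_mono) auto
      finally show "\<bar>exp (\<eta> \<bullet> a i) - exp (\<eta>' \<bullet> a i)\<bar> * norm (a i) \<le> ?\<Delta> * (16 / r\<^sup>2 * ?e i)" .
    qed
    also have "\<dots> \<le> ?\<Delta> * (16 / r\<^sup>2 * (n * W))"
      using W r unfolding sum_distrib_left[symmetric] by (intro mult_left_mono) auto
    finally show ?thesis .
  qed
  have N1: "norm (?S1 \<eta>') \<le> 2 / r * (n * W)"
  proof -
    have "norm (?S1 \<eta>') \<le> (\<Sum>i<n. 2 / r * ?e i)"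
    proof (rule sum_norm_le)
      fix i
      have "norm (exp (\<eta>' \<bullet> a i) *\<^sub>R a i) \<le> norm (a i) * ?h i"
        using inner[OF \<eta>(2), of i] by (simp add: mult.commute mult_left_mono)
      with b1[of i] show "norm (exp (\<eta>' \<bullet> a i) *\<^sub>R a i) \<le> 2 / r * ?e i" by linarith
    qed
    also have "\<dots> \<le> 2 / r * (n * W)"
      using W r unfolding sum_distrib_left[symmetric] by (intro mult_left_mono) auto
    finally show ?thesis .
  qed
  note pos = laplace_sum_pos[OF n, of a]
  have inv: "1 / ?S0 \<zeta> \<le> W / n" if "norm \<zeta> \<le> r / 2" for \<zeta>
    using S0_lower[OF that] pos[of \<zeta>] n W0 by (simp add: field_simps)
  have T': "norm (tilted_mean a n \<eta>') \<le> 2 * W\<^sup>2 / r"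
  proof -
    have "norm (tilted_mean a n \<eta>') = 1 / ?S0 \<eta>' * norm (?S1 \<eta>')"
      using pos[of \<eta>'] by (simp add: tilted_mean_def)
    also have "\<dots> \<le> W / n * (2 / r * (n * W))"
      using inv[OF \<eta>(2)] N1 W0 by (intro mult_mono) auto
    also have "\<dots> = 2 * W\<^sup>2 / r" using n by (simp add: power2_eq_square)
    finally show ?thesis .
  qed
  have "1 / ?S0 \<eta> - 1 / ?S0 \<eta>' = (1 / ?S0 \<eta>) * (?S0 \<eta>' - ?S0 \<eta>) * (1 / ?S0 \<eta>')"
    using pos[of \<eta>] pos[of \<eta>'] by (simp add: field_simps)
  then have e: "((1 / ?S0 \<eta>) * (?S0 \<eta>' - ?S0 \<eta>)) *\<^sub>R tilted_mean a n \<eta>'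
      = (1 / ?S0 \<eta> - 1 / ?S0 \<eta>') *\<^sub>R ?S1 \<eta>'"
    unfolding tilted_mean_def scaleR_scaleR by metis
  have norm_scaled: "norm ((1 / ?S0 \<eta>) *\<^sub>R u) = 1 / ?S0 \<eta> * norm u"
    "norm ((1 / ?S0 \<eta> * x) *\<^sub>R u) = 1 / ?S0 \<eta> * \<bar>x\<bar> * norm u" for u :: 'a and x
    using pos[of \<eta>] by (simp_all add: abs_mult)
  have decomposition: "tilted_mean a n \<eta> - tilted_mean a n \<eta>'
      = (1 / ?S0 \<eta>) *\<^sub>R (?S1 \<eta> - ?S1 \<eta>') + ((1 / ?S0 \<eta>) * (?S0 \<eta>' - ?S0 \<eta>)) *\<^sub>R tilted_mean a n \<eta>'"
    unfolding e unfolding tilted_mean_def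
    by (simp only: scaleR_diff_right scaleR_diff_left add_diff_eq diff_add_cancel)
  have "norm (tilted_mean a n \<eta> - tilted_mean a n \<eta>') \<le> 1 / ?S0 \<eta> * norm (?S1 \<eta> - ?S1 \<eta>')
      + 1 / ?S0 \<eta> * \<bar>?S0 \<eta>' - ?S0 \<eta>\<bar> * norm (tilted_mean a n \<eta>')"
    unfolding decomposition norm_scaled[symmetric] by (rule norm_triangle_ineq)
  also have "\<dots> \<le> W / n * (?\<Delta> * (16 / r\<^sup>2 * (n * W)))
      + W / n * (?\<Delta> * (2 / r * (n * W))) * (2 * W\<^sup>2 / r)"
  proof (rule add_mono)
    have Wn: "0 \<le> W / n" using W0 by simp
    show "1 / ?S0 \<eta> * norm (?S1 \<eta> - ?S1 \<eta>') \<le> W / n * (?\<Delta> * (16 / r\<^sup>2 * (n * W)))"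
      by (rule mult_mono[OF inv[OF \<eta>(1)] D1 Wn norm_ge_zero])
    have "0 \<le> ?\<Delta> * (2 / r * (n * W))" using D0 abs_ge_zero order_trans by blast
    then show "1 / ?S0 \<eta> * \<bar>?S0 \<eta>' - ?S0 \<eta>\<bar> * norm (tilted_mean a n \<eta>')
        \<le> W / n * (?\<Delta> * (2 / r * (n * W))) * (2 * W\<^sup>2 / r)"
      by (rule mult_mono[OF mult_mono[OF inv[OF \<eta>(1)] D0 Wn abs_ge_zero] T'
            mult_nonneg_nonneg[OF Wn] norm_ge_zero])
  qed
  also have "\<dots> = (16 * W^2 / r^2 + 4 * W^4 / r^2) * ?\<Delta>"
  proof -
    have "W / n * (?\<Delta> * (16 / r\<^sup>2 * (n * W))) = 16 * W\<^sup>2 / r\<^sup>2 * ?\<Delta>"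
      using n by (simp add: power2_eq_square)
    moreover have "W / n * (?\<Delta> * (2 / r * (n * W))) * (2 * W\<^sup>2 / r) = 4 * W ^ 4 / r\<^sup>2 * ?\<Delta>"
      using n by (simp add: power2_eq_square power4_eq_xxxx)
    ultimately show ?thesis by (simp only: distrib_right)
  qed
  finally show ?thesis .
qed

text \<open>
  The empirical cumulant function at \<open>(1 - q) *\<^sub>R \<theta>\<close>, divided by \<open>1 - q\<close>, and its limit for \<open>q \<rightarrow> 1\<close> when
  \<open>q = 1\<close>. In this form its gradient is a tilted mean for every \<open>q\<close>.
\<close>

definition scaled_cumulant :: "(nat \<Rightarrow> 'a::euclidean_space) \<Rightarrow> nat \<Rightarrow> real \<Rightarrow> 'a \<Rightarrow> real" where
  "scaled_cumulant a n q \<theta> = (if q = 1 then \<theta> \<bullet> tilted_mean a n 0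
     else ln (laplace_sum a n ((1 - q) *\<^sub>R \<theta>) / n) / (1 - q))"

lemma GDERIV_scaled_cumulant:
  assumes n: "n > 0"
  shows "GDERIV (scaled_cumulant a n q) \<theta> :> tilted_mean a n ((1 - q) *\<^sub>R \<theta>)"
proof (cases "q = 1")
  case True
  have "((\<lambda>\<theta>. \<theta> \<bullet> tilted_mean a n 0) has_derivative (\<lambda>h. h \<bullet> tilted_mean a n 0)) (at \<theta>)"
    by (auto intro!: derivative_eq_intros)
  then show ?thesis using True unfolding gderiv_def scaled_cumulant_def[abs_def] by simp
next
  case False
  define c where "c = 1 - q"
  have c: "c \<noteq> 0" using False by (simp add: c_def)
  have pos: "laplace_sum a n (c *\<^sub>R \<theta>) > 0" by (rule laplace_sum_pos[OF n])
  have S: "GDERIV (\<lambda>\<theta>. laplace_sum a n (c *\<^sub>R \<theta>)) \<theta> :> c *\<^sub>R (\<Sum>i<n. exp ((c *\<^sub>R \<theta>) \<bullet> a i) *\<^sub>R a i)"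
    unfolding gderiv_def laplace_sum_def
    by (auto intro!: derivative_eq_intros simp: inner_sum_right sum_distrib_left mult_ac)
  have "DERIV (\<lambda>x. ln (x / n) / c) (laplace_sum a n (c *\<^sub>R \<theta>)) :> 1 / (c * laplace_sum a n (c *\<^sub>R \<theta>))"
    using pos n c by (auto intro!: derivative_eq_intros)
  from GDERIV_DERIV_compose[OF S this]
  have "GDERIV (\<lambda>\<theta>. ln (laplace_sum a n (c *\<^sub>R \<theta>) / n) / c) \<theta> :> tilted_mean a n (c *\<^sub>R \<theta>)"
    using c by (simp add: tilted_mean_def)
  then show ?thesis using False unfolding scaled_cumulant_def[abs_def] c_def by simp
qed

section \<open>The Lq-likelihood of an exponential family\<close>

context full_rank_exponential_family begin

abbreviation "f \<equiv> expfam_density \<mu> b"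

text \<open>
  The factor \<open>exp (- (1 - q) * A \<theta>)\<close> is common to all observations. What remains of the sum is a
  \<open>laplace_sum\<close>, whose logarithm is, up to the constant \<open>ln n\<close>, the multiple \<open>1 - q\<close> of
  \<open>scaled_cumulant\<close>.
\<close>

lemma Lq_likelihood_eq:
  fixes xs :: "nat \<Rightarrow> 'x" and q :: real
  assumes n: "n > 0"
  defines "G \<equiv> \<lambda>\<theta>. scaled_cumulant (\<lambda>i. b (xs i)) n q \<theta> - A \<theta>"
  shows "Lq_likelihood f q n xs \<theta>
    = (if q = 1 then n * G \<theta> else n * ((exp ((1 - q) * G \<theta>) - 1) / (1 - q)))"
proof (cases "q = 1")
  case True
  have "tilted_mean (\<lambda>i. b (xs i)) n 0 = (1 / n) *\<^sub>R (\<Sum>i<n. b (xs i))"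
    by (simp add: tilted_mean_def laplace_sum_def)
  then show ?thesis using True n
    by (simp add: Lq_likelihood_def Lq_def expfam_density_def G_def scaled_cumulant_def
        sum_subtractf inner_sum_right right_diff_distrib)
next
  case False
  define c where "c = 1 - q"
  have c: "c \<noteq> 0" using False by (simp add: c_def)
  let ?S = "laplace_sum (\<lambda>i. b (xs i)) n (c *\<^sub>R \<theta>)"
  have pos: "?S > 0" by (rule laplace_sum_pos[OF n])
  have "c * G \<theta> = ln (?S / n) - c * A \<theta>"
    using False c by (simp add: G_def scaled_cumulant_def right_diff_distrib flip: c_def)
  then have "exp (c * G \<theta>) = ?S / n * exp (- (c * A \<theta>))"
    using pos n by (simp add: exp_diff exp_minus divide_inverse)
  then have 1: "n * exp (c * G \<theta>) = ?S * exp (- (c * A \<theta>))" using n by simp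
  have "f (xs i) \<theta> powr c = exp (- (c * A \<theta>)) * exp ((c *\<^sub>R \<theta>) \<bullet> b (xs i))" for i
    by (simp add: expfam_density_def powr_def right_diff_distrib flip: exp_add)
  then have "(\<Sum>i<n. f (xs i) \<theta> powr c) = ?S * exp (- (c * A \<theta>))"
    by (simp add: laplace_sum_def sum_distrib_left mult.commute)
  then have "(\<Sum>i<n. (f (xs i) \<theta> powr c - 1) / c) = (n * exp (c * G \<theta>) - n) / c"
    unfolding 1 by (simp add: sum_subtractf flip: sum_divide_distrib)
  then show ?thesis using False
    by (simp add: Lq_likelihood_def Lq_def right_diff_distrib flip: c_def)
qed

text \<open>
  In \<open>Lq_likelihood_eq\<close> the dependence on \<open>G\<close> is strictly increasing for each sign of \<open>1 - q\<close> and for \<open>q = 1\<close>.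
\<close>

lemma Lq_maximizers_eq:
  assumes n: "n > 0"
  shows "Lq_maximizers f Theta q n xs
    = {\<theta>. is_arg_max (\<lambda>\<theta>. scaled_cumulant (\<lambda>i. b (xs i)) n q \<theta> - A \<theta>) (\<lambda>t. t \<in> Theta) \<theta>}"
proof -
  let ?G = "\<lambda>\<theta>. scaled_cumulant (\<lambda>i. b (xs i)) n q \<theta> - A \<theta>"
  have "Lq_likelihood f q n xs \<theta> < Lq_likelihood f q n xs \<theta>' \<longleftrightarrow> ?G \<theta> < ?G \<theta>'" for \<theta> \<theta>'
  proof (cases "q < 1")
    case True
    then show ?thesis using n by (simp add: Lq_likelihood_eq divide_less_cancel)
  next
    case False
    then show ?thesis using n by (auto simp: Lq_likelihood_eq divide_less_cancel)
  qed
  then show ?thesis unfolding Lq_maximizers_def is_arg_max_def by simp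
qed

lemma score_eq:
  assumes "\<theta> \<in> interior N"
  shows "score f x \<theta> = b x - mean \<theta>"
proof -
  have "((\<lambda>t. t \<bullet> b x) has_derivative (\<lambda>h. h \<bullet> b x)) (at \<theta>)"
    by (auto intro!: derivative_eq_intros)
  then have "GDERIV (\<lambda>t. t \<bullet> b x) \<theta> :> b x" by (simp add: gderiv_def)
  from GDERIV_diff[OF this GDERIV_log_partition[OF assms]]
  have "GDERIV (\<lambda>t. ln (f x t)) \<theta> :> b x - mean \<theta>" by (simp add: expfam_density_def)
  then show ?thesis unfolding score_def by (intro the_equality) (auto dest: GDERIV_unique)
qed

text \<open>
  Up to a positive factor, the sum of the modified scores is the weighted sum of the deviations
  \<open>b (xs i) - mean \<theta>\<close> with the weights of the tilted mean.
\<close>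

lemma Lq_equation_solutions_eq:
  assumes n: "n > 0"
  shows "Lq_equation_solutions \<mu> b Theta q n xs
    = {\<theta> \<in> Theta \<inter> interior N. tilted_mean (\<lambda>i. b (xs i)) n ((1 - q) *\<^sub>R \<theta>) = mean \<theta>}"
proof -
  have "(\<Sum>i<n. modified_score f (xs i) \<theta> q) = 0
    \<longleftrightarrow> tilted_mean (\<lambda>i. b (xs i)) n ((1 - q) *\<^sub>R \<theta>) = mean \<theta>"
    if \<theta>: "\<theta> \<in> interior N" for \<theta>
  proof -
    define c where "c = 1 - q"
    let ?S = "laplace_sum (\<lambda>i. b (xs i)) n (c *\<^sub>R \<theta>)"
    let ?T = "tilted_mean (\<lambda>i. b (xs i)) n (c *\<^sub>R \<theta>)"
    have pos: "?S > 0" by (rule laplace_sum_pos[OF n])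
    have "modified_score f (xs i) \<theta> q
        = exp (- (c * A \<theta>)) *\<^sub>R (exp ((c *\<^sub>R \<theta>) \<bullet> b (xs i)) *\<^sub>R (b (xs i) - mean \<theta>))" for i
      by (simp add: modified_score_def score_eq[OF \<theta>] expfam_density_def powr_def right_diff_distrib
          flip: c_def exp_add)
    then have "(\<Sum>i<n. modified_score f (xs i) \<theta> q)
        = exp (- (c * A \<theta>)) *\<^sub>R (\<Sum>i<n. exp ((c *\<^sub>R \<theta>) \<bullet> b (xs i)) *\<^sub>R (b (xs i) - mean \<theta>))"
      by (simp add: scaleR_sum_right)
    also have "(\<Sum>i<n. exp ((c *\<^sub>R \<theta>) \<bullet> b (xs i)) *\<^sub>R (b (xs i) - mean \<theta>)) = ?S *\<^sub>R (?T - mean \<theta>)"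
      using pos by (simp add: tilted_mean_def scaleR_diff_right sum_subtractf laplace_sum_def
          flip: scaleR_sum_left)
    finally show ?thesis using pos by (simp add: c_def)
  qed
  then show ?thesis unfolding Lq_equation_solutions_def by auto
qed

text \<open>
  This applies \<open>unique_critical_point_and_maximizer\<close> with \<open>H\<close> the scaled cumulant function, whose
  gradient is \<open>tilted_mean\<close> at \<open>(1 - q) *\<^sub>R \<theta>\<close>. Since \<open>\<theta>\<close> ranges over a bounded set, this argument is small
  for \<open>q\<close> near \<open>1\<close>, and \<open>tilted_mean_Lipschitz\<close> gives both the closeness to \<open>mean \<theta>0\<close> and the small
  Lipschitz constant. The ball has to fit into \<open>Theta\<close>, into the region of strong convexity, and
  into the prescribed neighbourhood of \<open>\<theta>0\<close>.
\<close>

lemma Lq_solution_of_typical_sample: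
  assumes \<theta>0: "\<theta>0 \<in> interior Theta" and ThetaN: "Theta \<subseteq> N" and cpt: "compact Theta"
    and \<epsilon>: "\<epsilon> > 0" and r: "r > 0" and W: "W > 0"
  obtains \<tau> where "\<tau> > 0"
    "\<And>q n xs. n > 0 \<Longrightarrow> \<bar>1 - q\<bar> < \<tau> \<Longrightarrow> (\<Sum>i<n. exp (r * norm (b (xs i)))) \<le> real n * W \<Longrightarrow>
       norm (tilted_mean (\<lambda>i. b (xs i)) n 0 - mean \<theta>0) < \<tau> \<Longrightarrow>
       \<exists>\<theta>\<in>ball \<theta>0 \<epsilon>. Lq_equation_solutions \<mu> b Theta q n xs = {\<theta>} \<and> Lq_maximizers f Theta q n xs = {\<theta>}"
proof -
  have "\<theta>0 \<in> interior N" using \<theta>0 interior_mono[OF ThetaN] by blast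
  then obtain d \<kappa> where d: "d > 0" "cball \<theta>0 d \<subseteq> interior N" and \<kappa>: "\<kappa> > 0"
    and strong: "\<And>\<theta> \<theta>'. \<theta> \<in> cball \<theta>0 d \<Longrightarrow> \<theta>' \<in> cball \<theta>0 d \<Longrightarrow>
       A \<theta>' \<ge> A \<theta> + mean \<theta> \<bullet> (\<theta>' - \<theta>) + \<kappa> * (norm (\<theta>' - \<theta>))\<^sup>2"
    using log_partition_strongly_convex_near by metis
  obtain e where e: "e > 0" "cball \<theta>0 e \<subseteq> Theta" using \<theta>0 mem_interior_cball by metis
  define \<delta> where "\<delta> = min (min d e) \<epsilon>"
  have \<delta>: "\<delta> > 0" "\<delta> \<le> \<epsilon>" using d e \<epsilon> by (auto simp: \<delta>_def)
  have \<delta>d: "cball \<theta>0 \<delta> \<subseteq> cball \<theta>0 d" and \<delta>e: "cball \<theta>0 \<delta> \<subseteq> cball \<theta>0 e"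
    by (auto simp: \<delta>_def)
  obtain R where R: "R > 0" "Theta \<subseteq> cball 0 R"
    using compact_imp_bounded[OF cpt] bounded_subset_ballD[of Theta 0] ball_subset_cball by (metis order_trans)
  define L where "L = 16 * W^2 / r^2 + 4 * W^4 / r^2"
  have L: "L > 0" using W r by (simp add: L_def add_pos_pos)
  \<comment> \<open>The four bounds serve, in this order, to keep \<open>(1 - q) *\<^sub>R \<theta>\<close> in the domain of the Lipschitz estimate, to
     bound the deviation of the sample mean, to bound the effect of the tilt, and to keep the
     Lipschitz constant of the tilted mean below that of strong monotonicity.\<close>
  define \<tau> where "\<tau> = Min {r / 2 / R, \<kappa> * \<delta> / 2, \<kappa> * \<delta> / 2 / (L * R), 2 * \<kappa> / L}"
  have \<tau>: "\<tau> > 0" using r R \<kappa> \<delta> L by (simp add: \<tau>_def)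
  have \<tau>le: "\<tau> \<le> r / 2 / R" "\<tau> \<le> \<kappa> * \<delta> / 2" "\<tau> \<le> \<kappa> * \<delta> / 2 / (L * R)" "\<tau> \<le> 2 * \<kappa> / L"
    unfolding \<tau>_def by (intro Min_le; simp)+
  show ?thesis
  proof (rule that[OF \<tau>])
    fix q :: real and n :: nat and xs :: "nat \<Rightarrow> 'x"
    assume n: "n > 0" and q: "\<bar>1 - q\<bar> < \<tau>" and bound: "(\<Sum>i<n. exp (r * norm (b (xs i)))) \<le> real n * W"
      and avg: "norm (tilted_mean (\<lambda>i. b (xs i)) n 0 - mean \<theta>0) < \<tau>"
    let ?T = "tilted_mean (\<lambda>i. b (xs i)) n"
    let ?h = "\<lambda>\<theta>. ?T ((1 - q) *\<^sub>R \<theta>)"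
    have small: "norm ((1 - q) *\<^sub>R \<theta>) \<le> r / 2" if "\<theta> \<in> cball 0 R" for \<theta> :: "real ^ 'p"
    proof -
      have "\<bar>1 - q\<bar> * norm \<theta> \<le> (r / 2 / R) * R"
        using q \<tau>le(1) that R(1) r by (intro mult_mono) auto
      then show ?thesis using R(1) by simp
    qed
    have Lip: "norm (?T \<eta> - ?T \<eta>') \<le> L * norm (\<eta> - \<eta>')" if "norm \<eta> \<le> r / 2" "norm \<eta>' \<le> r / 2" for \<eta> \<eta>'
      unfolding L_def using tilted_mean_Lipschitz[OF n r bound that] .
    have lip: "norm (?h \<theta> - ?h \<theta>') \<le> (L * \<bar>1 - q\<bar>) * norm (\<theta> - \<theta>')"
      if "\<theta> \<in> cball 0 R" "\<theta>' \<in> cball 0 R" for \<theta> \<theta>'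
      using Lip[OF small[OF that(1)] small[OF that(2)]] by (simp flip: scaleR_diff_right)
    have close: "norm (?h \<theta> - mean \<theta>0) < \<kappa> * \<delta>" if "\<theta> \<in> cball 0 R" for \<theta>
    proof -
      have "norm (?h \<theta> - ?T 0) \<le> (L * \<bar>1 - q\<bar>) * norm \<theta>"
        using Lip[OF small[OF that], of 0] r by simp
      also have "\<dots> \<le> (L * (\<kappa> * \<delta> / 2 / (L * R))) * R"
        using q \<tau>le(3) that R(1) L \<kappa> \<delta>(1) by (intro mult_mono) auto
      also have "\<dots> = \<kappa> * \<delta> / 2" using L R(1) by simp
      finally have "norm (?h \<theta> - ?T 0) \<le> \<kappa> * \<delta> / 2" .
      moreover have "norm (?h \<theta> - mean \<theta>0) \<le> norm (?h \<theta> - ?T 0) + norm (?T 0 - mean \<theta>0)"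
        using norm_triangle_ineq[of "?h \<theta> - ?T 0" "?T 0 - mean \<theta>0"] by simp
      ultimately show ?thesis using avg \<tau>le(2) by linarith
    qed
    have "L * \<bar>1 - q\<bar> < L * (2 * \<kappa> / L)" using q \<tau>le(4) L by (intro mult_strict_left_mono) auto
    then have small_lip: "L * \<bar>1 - q\<bar> < 2 * \<kappa>" using L by simp
    obtain \<theta> where "\<theta> \<in> ball \<theta>0 \<delta>" "{\<theta> \<in> Theta \<inter> interior N. ?h \<theta> = mean \<theta>} = {\<theta>}"
      "{\<theta>. is_arg_max (\<lambda>\<theta>. scaled_cumulant (\<lambda>i. b (xs i)) n q \<theta> - A \<theta>) (\<lambda>t. t \<in> Theta) \<theta>} = {\<theta>}"
    proof (rule unique_critical_point_and_maximizer[where A = A and m = mean and h = ?h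
          and H = "scaled_cumulant (\<lambda>i. b (xs i)) n q" and C = "cball 0 R" and Theta = Theta
          and D = "interior N" and L = "L * \<bar>1 - q\<bar>" and \<kappa> = \<kappa> and \<delta> = \<delta> and c = \<theta>0])
      show "cball \<theta>0 \<delta> \<subseteq> Theta" using \<delta>e e(2) by blast
      show "cball \<theta>0 \<delta> \<subseteq> interior N" using \<delta>d d(2) by blast
      show "A \<theta>' \<ge> A \<theta> + mean \<theta> \<bullet> (\<theta>' - \<theta>)" if "\<theta> \<in> interior N" "\<theta>' \<in> Theta" for \<theta> \<theta>'
        using log_partition_above_tangent that ThetaN by blast
      show "A \<theta>' \<ge> A \<theta> + mean \<theta> \<bullet> (\<theta>' - \<theta>) + \<kappa> * (norm (\<theta>' - \<theta>))\<^sup>2"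
        if "\<theta> \<in> cball \<theta>0 \<delta>" "\<theta>' \<in> cball \<theta>0 \<delta>" for \<theta> \<theta>'
        using strong \<delta>d that by blast
    qed (use \<delta>(1) R(2) GDERIV_log_partition GDERIV_scaled_cumulant[OF n] close lip small_lip in auto)
    then show "\<exists>\<theta>\<in>ball \<theta>0 \<epsilon>. Lq_equation_solutions \<mu> b Theta q n xs = {\<theta>} \<and> Lq_maximizers f Theta q n xs = {\<theta>}"
      unfolding Lq_equation_solutions_eq[OF n] Lq_maximizers_eq[OF n]
      using \<delta>(2) by (intro bexI[of _ \<theta>]) auto
  qed
qed

text \<open>
  The weak law is applied to the coordinates of \<open>b\<close> and to \<open>exp (r * norm b)\<close>. Its proof uses second
  moments, so \<open>r\<close> is half of the exponent \<open>s\<close> for which an exponential moment is available.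
\<close>

lemma typical_sample:
  fixes P :: "'w measure" and X :: "nat \<Rightarrow> 'w \<Rightarrow> 'x"
  assumes P: "prob_space P" and indep: "prob_space.indep_vars P (\<lambda>_. \<mu>) X UNIV"
    and density: "\<And>i. distributed P \<mu> (X i) (\<lambda>x. ennreal (f x \<theta>0))"
    and \<theta>0: "\<theta>0 \<in> interior N"
  obtains r W :: real where "r > 0" "W > 0"
    "\<And>\<tau>. \<tau> > 0 \<Longrightarrow> with_prob_to_1 P (\<lambda>n w. (\<Sum>i<n. exp (r * norm (b (X i w)))) \<le> real n * W \<and>
       norm (tilted_mean (\<lambda>i. b (X i w)) n 0 - mean \<theta>0) < \<tau>)"
proof -
  interpret P: prob_space P by (rule P)
  obtain s where s: "s > 0" and ints: "integrable \<mu> (\<lambda>x. exp (\<theta>0 \<bullet> b x + s * norm (b x)))"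
    using exponential_moment[OF \<theta>0] .
  have \<theta>N: "\<theta>0 \<in> N" using \<theta>0 interior_subset by blast
  have f_eq: "f x \<theta>0 = exp (\<theta>0 \<bullet> b x) / Z \<theta>0" for x
    by (simp add: expfam_density_def exp_diff exp_A \<theta>N)
  have law: "integrable P (\<lambda>w. g (X i w))" "P.expectation (\<lambda>w. g (X i w)) = (\<integral>x. f x \<theta>0 * g x \<partial>\<mu>)"
    if g [measurable]: "g \<in> borel_measurable \<mu>" and K: "\<And>x. \<bar>g x\<bar> \<le> K * exp (s * norm (b x))" for g K i
  proof -
    have f0: "0 \<le> f x \<theta>0" for x by (simp add: expfam_density_def)
    have "integrable \<mu> (\<lambda>x. f x \<theta>0 * g x)"
    proof (rule integrable_of_exp_bound[OF ints, where K = "K / Z \<theta>0"])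
      fix x
      have "exp (\<theta>0 \<bullet> b x) * \<bar>g x\<bar> \<le> exp (\<theta>0 \<bullet> b x) * (K * exp (s * norm (b x)))"
        using K by (intro mult_left_mono) auto
      then show "norm (f x \<theta>0 * g x) \<le> K / Z \<theta>0 * exp (\<theta>0 \<bullet> b x + s * norm (b x))"
        using Z_pos[OF \<theta>N] by (simp add: f_eq abs_mult exp_add divide_simps mult_ac)
    qed (unfold f_eq, measurable)
    then show "integrable P (\<lambda>w. g (X i w))"
      using distributed_integrable[OF density g f0] by blast
    show "P.expectation (\<lambda>w. g (X i w)) = (\<integral>x. f x \<theta>0 * g x \<partial>\<mu>)"
      using distributed_integral[OF density g f0] by simp
  qed
  have lln: "with_prob_to_1 P (\<lambda>n w. \<bar>(\<Sum>i<n. g (X i w)) / n - (\<integral>x. f x \<theta>0 * g x \<partial>\<mu>)\<bar> < \<epsilon>)"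
    if [measurable]: "g \<in> borel_measurable \<mu>"
      and K: "\<And>x. \<bar>g x\<bar> \<le> K * exp (s * norm (b x))" and K': "\<And>x. (g x)\<^sup>2 \<le> K' * exp (s * norm (b x))"
      and \<epsilon>: "\<epsilon> > 0" for g K K' \<epsilon>
  proof (rule P.weak_law_of_large_numbers[OF _ _ _ _ _ \<epsilon>])
    show "P.indep_vars (\<lambda>_. borel) (\<lambda>i w. g (X i w)) UNIV"
      using P.indep_vars_compose2[OF indep, of "\<lambda>_. g" "\<lambda>_. borel"] by simp
    have sq: "(\<lambda>x. (g x)\<^sup>2) \<in> borel_measurable \<mu>" "\<bar>(g x)\<^sup>2\<bar> \<le> K' * exp (s * norm (b x))" for x
      using K' by auto
    show "integrable P (\<lambda>w. g (X i w))" "P.expectation (\<lambda>w. g (X i w)) = (\<integral>x. f x \<theta>0 * g x \<partial>\<mu>)"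
      "integrable P (\<lambda>w. (g (X i w))\<^sup>2)"
      "P.expectation (\<lambda>w. (g (X i w))\<^sup>2) = (\<integral>x. f x \<theta>0 * (g x)\<^sup>2 \<partial>\<mu>)" for i
      using law[of g K i] law[OF sq, of i] K that(1) by auto
  qed
  define r where "r = s / 2"
  have r: "r > 0" using s by (simp add: r_def)
  define e where "e = (\<integral>x. f x \<theta>0 * exp (r * norm (b x)) \<partial>\<mu>)"
  have e: "e \<ge> 0" unfolding e_def by (intro Bochner_Integration.integral_nonneg) (simp add: expfam_density_def)
  have lln_exp: "with_prob_to_1 P (\<lambda>n w. \<bar>(\<Sum>i<n. exp (r * norm (b (X i w)))) / n - e\<bar> < 1)"
    unfolding e_def
  proof (rule lln[of _ 1 1])
    show "\<bar>exp (r * norm (b x))\<bar> \<le> 1 * exp (s * norm (b x))" for x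
      using s by (simp add: r_def)
    show "(exp (r * norm (b x)))\<^sup>2 \<le> 1 * exp (s * norm (b x))" for x
      by (simp add: r_def power2_eq_square flip: exp_add)
  qed auto
  have lln_b: "with_prob_to_1 P (\<lambda>n w. \<bar>(\<Sum>i<n. b (X i w) $ j) / n - mean \<theta>0 $ j\<bar> < \<epsilon>)"
    if \<epsilon>: "\<epsilon> > 0" for j \<epsilon>
  proof -
    have "(\<integral>x. f x \<theta>0 * b x $ j \<partial>\<mu>) = (\<integral>x. exp (\<theta>0 \<bullet> b x) * (axis j 1 \<bullet> b x) \<partial>\<mu>) / Z \<theta>0"
      by (simp add: f_eq inner_axis' flip: integral_divide_zero)
    also have "\<dots> = mean \<theta>0 $ j"
      using integral_exp_inner(2)[OF \<theta>0, of "axis j 1"] Z_pos[OF \<theta>N] by (simp add: inner_axis')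
    finally have m: "(\<integral>x. f x \<theta>0 * b x $ j \<partial>\<mu>) = mean \<theta>0 $ j" .
    show ?thesis
      unfolding m[symmetric]
    proof (rule lln[of _ "1 / s" "4 / s\<^sup>2", OF _ _ _ \<epsilon>])
      have "(\<lambda>x. b x \<bullet> axis j 1) \<in> borel_measurable \<mu>" by measurable
      then show "(\<lambda>x. b x $ j) \<in> borel_measurable \<mu>" by (simp add: inner_axis)
      show "\<bar>b x $ j\<bar> \<le> 1 / s * exp (s * norm (b x))" for x
        using component_le_norm_cart[of "b x" j] power_le_exp(1)[of "norm (b x)" s] s by simp
      show "(b x $ j)\<^sup>2 \<le> 4 / s\<^sup>2 * exp (s * norm (b x))" for x
        using power_le_exp(2)[of "norm (b x)" s] s
          power_mono[OF component_le_norm_cart[of "b x" j] abs_ge_zero, of 2] by simp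
    qed
  qed
  show ?thesis
  proof (rule that[OF r])
    show "e + 1 > 0" using e by simp
    fix \<tau> :: real assume \<tau>: "\<tau> > 0"
    define \<epsilon> where "\<epsilon> = \<tau> / CARD('p)"
    have \<epsilon>: "\<epsilon> > 0" using \<tau> by (simp add: \<epsilon>_def)
    have "with_prob_to_1 P (\<lambda>n w. \<bar>(\<Sum>i<n. exp (r * norm (b (X i w)))) / n - e\<bar> < 1 \<and>
        (\<forall>j\<in>UNIV. \<bar>(\<Sum>i<n. b (X i w) $ j) / n - mean \<theta>0 $ j\<bar> < \<epsilon>))"
      by (intro P.with_prob_to_1_conj P.with_prob_to_1_ball lln_exp lln_b \<epsilon>) simp
    then show "with_prob_to_1 P (\<lambda>n w. (\<Sum>i<n. exp (r * norm (b (X i w)))) \<le> real n * (e + 1) \<and>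
       norm (tilted_mean (\<lambda>i. b (X i w)) n 0 - mean \<theta>0) < \<tau>)"
    proof (rule with_prob_to_1_mono)
      fix n w
      assume *: "\<bar>(\<Sum>i<n. exp (r * norm (b (X i w)))) / n - e\<bar> < 1 \<and>
        (\<forall>j\<in>UNIV. \<bar>(\<Sum>i<n. b (X i w) $ j) / n - mean \<theta>0 $ j\<bar> < \<epsilon>)"
      let ?d = "tilted_mean (\<lambda>i. b (X i w)) n 0 - mean \<theta>0"
      have "(\<Sum>i<n. exp (r * norm (b (X i w)))) \<le> real n * (e + 1)"
      proof (cases "n = 0")
        case False
        then show ?thesis using * by (auto simp: abs_if field_simps split: if_splits)
      qed simp
      moreover have "?d $ j = (\<Sum>i<n. b (X i w) $ j) / n - mean \<theta>0 $ j" for j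
        by (simp add: tilted_mean_def laplace_sum_def)
      then have "(\<Sum>j\<in>UNIV. \<bar>?d $ j\<bar>) < (\<Sum>j\<in>(UNIV :: 'p set). \<epsilon>)"
        using * by (intro sum_strict_mono) auto
      then have "norm ?d < \<tau>"
        using norm_le_l1_cart[of ?d] by (simp add: \<epsilon>_def)
      ultimately show "(\<Sum>i<n. exp (r * norm (b (X i w)))) \<le> real n * (e + 1) \<and> norm ?d < \<tau>" by blast
    qed
  qed
qed

end

section \<open>Existence, uniqueness and consistency of the estimator\<close>

theorem theorem3p1:
  fixes \<mu> :: "'x measure"
    and b :: "'x \<Rightarrow> real ^ 'p"
    and Theta :: "(real ^ 'p) set"
    and \<theta>\<^sub>0 :: "real ^ 'p"
    and P :: "'w measure"
    and X :: "nat \<Rightarrow> 'w \<Rightarrow> 'x"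
    and q :: "nat \<Rightarrow> real"
  assumes sigma_finite: "sigma_finite_measure \<mu>"
    and b_measurable: "\<And>j. (\<lambda>x. b x $ j) \<in> borel_measurable \<mu>"
    and A_finite: "Theta \<subseteq> natural_space \<mu> b"
    and full_rank: "full_rank \<mu> b"
    and prob: "prob_space P"
    and indep: "prob_space.indep_vars P (\<lambda>_. \<mu>) X UNIV"
    and density: "\<And>i. distributed P \<mu> (X i) (\<lambda>x. ennreal (expfam_density \<mu> b x \<theta>\<^sub>0))"
    and q_pos: "\<And>n. q n > 0"
    and q_lim: "q \<longlonglongrightarrow> 1"
    and compact: "compact Theta"
    and interior: "\<theta>\<^sub>0 \<in> interior Theta"
  shows "with_prob_to_1 P (\<lambda>n w. \<exists>\<theta>.
           Lq_equation_solutions \<mu> b Theta (q n) n (\<lambda>i. X i w) = {\<theta>} \<and>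
           Lq_maximizers (expfam_density \<mu> b) Theta (q n) n (\<lambda>i. X i w) = {\<theta>})
    \<and> (\<forall>T :: nat \<Rightarrow> 'w \<Rightarrow> real ^ 'p.
         (\<forall>n. \<forall>w\<in>space P. \<forall>\<theta>.
            Lq_equation_solutions \<mu> b Theta (q n) n (\<lambda>i. X i w) = {\<theta>} \<and>
            Lq_maximizers (expfam_density \<mu> b) Theta (q n) n (\<lambda>i. X i w) = {\<theta>}
            \<longrightarrow> T n w = \<theta>)
         \<longrightarrow> converges_in_prob P T \<theta>\<^sub>0)"
proof -
  have "b \<in> borel_measurable \<mu>"
    unfolding borel_measurable_euclidean_space[of b]
    using b_measurable by (auto simp: Basis_vec_def inner_axis)
  then interpret full_rank_exponential_family \<mu> b
    using full_rank by unfold_locales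
  have \<theta>\<^sub>0_interior: "\<theta>\<^sub>0 \<in> interior (natural_space \<mu> b)"
    using interior interior_mono[OF A_finite] by blast
  obtain r W :: real where r: "r > 0" and W: "W > 0" and typical:
    "\<And>\<tau>. \<tau> > 0 \<Longrightarrow> with_prob_to_1 P (\<lambda>n w. (\<Sum>i<n. exp (r * norm (b (X i w)))) \<le> real n * W \<and>
       norm (tilted_mean (\<lambda>i. b (X i w)) n 0 - mean \<theta>\<^sub>0) < \<tau>)"
    using typical_sample[OF prob indep density \<theta>\<^sub>0_interior] by blast
  let ?solves = "\<lambda>n w \<theta>. Lq_equation_solutions \<mu> b Theta (q n) n (\<lambda>i. X i w) = {\<theta>} \<and>
    Lq_maximizers (expfam_density \<mu> b) Theta (q n) n (\<lambda>i. X i w) = {\<theta>}"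
  have local: "with_prob_to_1 P (\<lambda>n w. \<exists>\<theta>\<in>ball \<theta>\<^sub>0 \<epsilon>. ?solves n w \<theta>)" if \<epsilon>: "\<epsilon> > 0" for \<epsilon>
  proof -
    obtain \<tau> where \<tau>: "\<tau> > 0" and solve:
      "\<And>q n xs. n > 0 \<Longrightarrow> \<bar>1 - q\<bar> < \<tau> \<Longrightarrow> (\<Sum>i<n. exp (r * norm (b (xs i)))) \<le> real n * W \<Longrightarrow>
       norm (tilted_mean (\<lambda>i. b (xs i)) n 0 - mean \<theta>\<^sub>0) < \<tau> \<Longrightarrow>
       \<exists>\<theta>\<in>ball \<theta>\<^sub>0 \<epsilon>. Lq_equation_solutions \<mu> b Theta q n xs = {\<theta>} \<and>
         Lq_maximizers (expfam_density \<mu> b) Theta q n xs = {\<theta>}"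
      using Lq_solution_of_typical_sample[OF interior A_finite compact \<epsilon> r W] by blast
    have "\<forall>\<^sub>F n in sequentially. n > 0 \<and> \<bar>1 - q n\<bar> < \<tau>"
      using eventually_gt_at_top[of "0::nat"] tendstoD[OF q_lim \<tau>]
      by eventually_elim (simp add: dist_real_def abs_minus_commute)
    then show ?thesis
      by (intro with_prob_to_1_eventually[OF typical[OF \<tau>]])
        (auto elim!: eventually_mono intro!: solve)
  qed
  show ?thesis
  proof (intro conjI allI impI)
    show "with_prob_to_1 P (\<lambda>n w. \<exists>\<theta>. ?solves n w \<theta>)"
      using local[of 1] by (rule with_prob_to_1_mono) auto
    fix T :: "nat \<Rightarrow> 'w \<Rightarrow> real ^ 'p"
    assume T: "\<forall>n. \<forall>w\<in>space P. \<forall>\<theta>. ?solves n w \<theta> \<longrightarrow> T n w = \<theta>"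
    show "converges_in_prob P T \<theta>\<^sub>0"
      unfolding converges_in_prob_def
    proof (intro allI impI)
      fix \<epsilon> :: real assume "\<epsilon> > 0"
      from local[OF this] show "with_prob_to_1 P (\<lambda>n w. dist (T n w) \<theta>\<^sub>0 < \<epsilon>)"
      proof (rule with_prob_to_1_mono)
        fix n w assume "w \<in> space P" "\<exists>\<theta>\<in>ball \<theta>\<^sub>0 \<epsilon>. ?solves n w \<theta>"
        then obtain \<theta> where "\<theta> \<in> ball \<theta>\<^sub>0 \<epsilon>" "T n w = \<theta>" using T by blast
        then show "dist (T n w) \<theta>\<^sub>0 < \<epsilon>" by (simp add: dist_commute)
      qed
    qed
  qed
qed

end
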